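(* Let $G$ be a finite group and $P$ a $p$-subgroup of $G$. Assume $P\le\ker(S(G,P))$ and that $N_G(P)$ is a $p$-group. If $S(N_G(P),P)$ is Brauer indecomposable, then $S(G,P)$ is Brauer indecomposable.
   Context: Throughout, $p$ is a prime and $k$ is an algebraically closed field of characteristic $p$; all modules are finite dimensional. For a $kG$-module $M$, $\ker(M)=\{g\in G: gm=m \text{ for all } m\in M\}$. For $H\le G$, $S(G,H)$ denotes the Scott module: the unique indecomposable direct summand of $\mathrm{Ind}_H^G(k)$ containing the trivial $kG$-module in its socle (equivalently, in its head). For a $kG$-module $M$ and a $p$-subgroup $Q\le G$, the Brauer construction is $M(Q)=M^Q/\sum_{R<Q}\mathrm{Tr}_R^Q(M^R)$, a $kN_G(Q)$-module. $M$ is Brauer indecomposable if for every $p$-subgroup $Q\le G$, $\mathrm{Res}^{N_G(Q)}_{QC_G(Q)} M(Q)$ is indecomposable or zero. *)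

theory Defs
  imports "HOL-Algebra.Group_Action" "HOL-Computational_Algebra.Polynomial"
begin

definition alg_closed_field :: "'k::field itself \<Rightarrow> bool" where
  "alg_closed_field _ = (\<forall>q :: 'k poly. degree q \<noteq> 0 \<longrightarrow> (\<exists>x. poly q x = 0))"

definition p_group_set :: "nat \<Rightarrow> 'g set \<Rightarrow> bool" where
  "p_group_set p Q = (finite Q \<and> (\<exists>n. card Q = p ^ n))"

definition p_subgroup :: "('g, 'b) monoid_scheme \<Rightarrow> nat \<Rightarrow> 'g set \<Rightarrow> bool" where
  "p_subgroup G p Q = (subgroup Q G \<and> p_group_set p Q)"

definition centralizer :: "('g, 'b) monoid_scheme \<Rightarrow> 'g set \<Rightarrow> 'g set" where
  "centralizer G Q = {c \<in> carrier G. \<forall>q\<in>Q. c \<otimes>\<^bsub>G\<^esub> q = q \<otimes>\<^bsub>G\<^esub> c}"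

text \<open>All modules are realised as k-subspaces of a function space 'x => 'k with a
  group acting by maps rho g.\<close>

definition fsubspace :: "('x \<Rightarrow> 'k::field) set \<Rightarrow> bool" where
  "fsubspace V = ((\<lambda>_. 0) \<in> V \<and> (\<forall>v\<in>V. \<forall>w\<in>V. (\<lambda>x. v x + w x) \<in> V)
                  \<and> (\<forall>c. \<forall>v\<in>V. (\<lambda>x. c * v x) \<in> V))"

definition ssum :: "('x \<Rightarrow> 'k::field) set \<Rightarrow> ('x \<Rightarrow> 'k) set \<Rightarrow> ('x \<Rightarrow> 'k) set" where
  "ssum C D = {(\<lambda>x. c x + d x) | c d. c \<in> C \<and> d \<in> D}"

definition stable_sub :: "'g set \<Rightarrow> ('g \<Rightarrow> ('x \<Rightarrow> 'k::field) \<Rightarrow> ('x \<Rightarrow> 'k))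
    \<Rightarrow> ('x \<Rightarrow> 'k) set \<Rightarrow> ('x \<Rightarrow> 'k) set \<Rightarrow> bool" where
  "stable_sub H \<rho> V W = (fsubspace W \<and> W \<subseteq> V \<and> (\<forall>h\<in>H. \<forall>w\<in>W. \<rho> h w \<in> W))"

definition indecomposable :: "'g set \<Rightarrow> ('g \<Rightarrow> ('x \<Rightarrow> 'k::field) \<Rightarrow> ('x \<Rightarrow> 'k))
    \<Rightarrow> ('x \<Rightarrow> 'k) set \<Rightarrow> bool" where
  "indecomposable H \<rho> V = (V \<noteq> {\<lambda>_. 0} \<and>
     \<not> (\<exists>C D. stable_sub H \<rho> V C \<and> stable_sub H \<rho> V D \<and> C \<noteq> {\<lambda>_. 0} \<and> D \<noteq> {\<lambda>_. 0}
            \<and> ssum C D = V \<and> C \<inter> D = {\<lambda>_. 0}))"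

definition fixed_pts :: "'g set \<Rightarrow> ('g \<Rightarrow> ('x \<Rightarrow> 'k::field) \<Rightarrow> ('x \<Rightarrow> 'k))
    \<Rightarrow> ('x \<Rightarrow> 'k) set \<Rightarrow> ('x \<Rightarrow> 'k) set" where
  "fixed_pts Q \<rho> V = {v \<in> V. \<forall>g\<in>Q. \<rho> g v = v}"

definition rel_trace :: "('g, 'b) monoid_scheme \<Rightarrow> 'g set \<Rightarrow> 'g set
    \<Rightarrow> ('g \<Rightarrow> ('x \<Rightarrow> 'k::field) \<Rightarrow> ('x \<Rightarrow> 'k)) \<Rightarrow> ('x \<Rightarrow> 'k) \<Rightarrow> ('x \<Rightarrow> 'k)" where
  "rel_trace G Q R \<rho> v =
     (\<lambda>x. \<Sum>C \<in> (\<lambda>t. t <#\<^bsub>G\<^esub> R) ` Q. \<rho> (SOME t. t \<in> C) v x)"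

definition brauer_kernel :: "('g, 'b) monoid_scheme \<Rightarrow> 'g set
    \<Rightarrow> ('g \<Rightarrow> ('x \<Rightarrow> 'k::field) \<Rightarrow> ('x \<Rightarrow> 'k)) \<Rightarrow> ('x \<Rightarrow> 'k) set \<Rightarrow> ('x \<Rightarrow> 'k) set" where
  "brauer_kernel G Q \<rho> V =
     {(\<lambda>x. \<Sum>R \<in> {R. subgroup R G \<and> R \<subset> Q}. f R x) | f.
        \<forall>R \<in> {R. subgroup R G \<and> R \<subset> Q}. f R \<in> rel_trace G Q R \<rho> ` fixed_pts R \<rho> V}"

text \<open>The Brauer construction V(Q) = V^Q / brauer_kernel is the subquotient
  A/B with A = fixed_pts Q, B = brauer_kernel.  Its restriction to a group H
  (acting on A and preserving B) is indecomposable or zero iff there is no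
  decomposition of A/B into two nonzero H-submodules; by the correspondence
  theorem such decompositions are exactly pairs of H-stable subspaces C, D
  with B \<subseteq> C, D \<subseteq> A, C \<noteq> B, D \<noteq> B, C + D = A, C \<inter> D = B.\<close>
definition subquot_indec_or_zero :: "'g set \<Rightarrow> ('g \<Rightarrow> ('x \<Rightarrow> 'k::field) \<Rightarrow> ('x \<Rightarrow> 'k))
    \<Rightarrow> ('x \<Rightarrow> 'k) set \<Rightarrow> ('x \<Rightarrow> 'k) set \<Rightarrow> bool" where
  "subquot_indec_or_zero H \<rho> A B =
     (\<not> (\<exists>C D. stable_sub H \<rho> A C \<and> stable_sub H \<rho> A D \<and> B \<subseteq> C \<and> B \<subseteq> D
            \<and> C \<noteq> B \<and> D \<noteq> B \<and> ssum C D = A \<and> C \<inter> D = B))"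

definition brauer_indecomposable :: "('g, 'b) monoid_scheme \<Rightarrow> nat
    \<Rightarrow> ('g \<Rightarrow> ('x \<Rightarrow> 'k::field) \<Rightarrow> ('x \<Rightarrow> 'k)) \<Rightarrow> ('x \<Rightarrow> 'k) set \<Rightarrow> bool" where
  "brauer_indecomposable G p \<rho> V =
     (\<forall>Q. p_subgroup G p Q \<longrightarrow>
        subquot_indec_or_zero (Q <#>\<^bsub>G\<^esub> centralizer G Q) \<rho>
           (fixed_pts Q \<rho> V) (brauer_kernel G Q \<rho> V))"

definition module_kernel :: "('g, 'b) monoid_scheme
    \<Rightarrow> ('g \<Rightarrow> ('x \<Rightarrow> 'k::field) \<Rightarrow> ('x \<Rightarrow> 'k)) \<Rightarrow> ('x \<Rightarrow> 'k) set \<Rightarrow> 'g set" where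
  "module_kernel G \<rho> V = {g \<in> carrier G. \<forall>v\<in>V. \<rho> g v = v}"

text \<open>Ind_H^G(k) realised as the k-valued functions on G that are constant on the
  left cosets gH (i.e. functions on G/H), vanishing outside G, with G acting by
  left translation: (g.f)(x) = f(g^-1 x).\<close>
definition ind_space :: "('g, 'b) monoid_scheme \<Rightarrow> 'g set \<Rightarrow> ('g \<Rightarrow> 'k::field) set" where
  "ind_space G H = {f. (\<forall>x. x \<notin> carrier G \<longrightarrow> f x = 0)
                        \<and> (\<forall>x\<in>carrier G. \<forall>h\<in>H. f (x \<otimes>\<^bsub>G\<^esub> h) = f x)}"

definition ind_action :: "('g, 'b) monoid_scheme \<Rightarrow> 'g \<Rightarrow> ('g \<Rightarrow> 'k::field) \<Rightarrow> ('g \<Rightarrow> 'k)" where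
  "ind_action G g f = (\<lambda>x. if x \<in> carrier G then f (inv\<^bsub>G\<^esub> g \<otimes>\<^bsub>G\<^esub> x) else 0)"

text \<open>M is (a copy of) the Scott module S(G,H): an indecomposable direct summand of
  Ind_H^G(k) whose socle contains the trivial module (i.e. M has a nonzero
  G-fixed vector).\<close>
definition scott_module :: "('g, 'b) monoid_scheme \<Rightarrow> 'g set \<Rightarrow> ('g \<Rightarrow> 'k::field) set \<Rightarrow> bool" where
  "scott_module G H M =
     (stable_sub (carrier G) (ind_action G) (ind_space G H) M
      \<and> (\<exists>W. stable_sub (carrier G) (ind_action G) (ind_space G H) W
             \<and> ssum M W = ind_space G H \<and> M \<inter> W = {\<lambda>_. 0})
      \<and> indecomposable (carrier G) (ind_action G) M
      \<and> (\<exists>v\<in>M. v \<noteq> (\<lambda>_. 0) \<and> (\<forall>g\<in>carrier G. ind_action G g v = v)))"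

end

theory Submission
  imports Defs "HOL-Algebra.Left_Coset" "HOL-Algebra.Zassenhaus" "HOL-Library.Indicator_Function"
begin

text \<open>
  Let \<open>K\<close> be the kernel of the Scott module \<open>M\<close> and \<open>N\<close> the normalizer of \<open>P\<close>.
  Write the indicator of \<open>P\<close> as \<open>m + w\<close> along \<open>Ind = M + W\<close>. Tracing it from \<open>P\<close> to \<open>K\<close> multiplies
  \<open>m\<close> by the index \<open>|K : P|\<close>; if \<open>p\<close> divided this index, then the indicator of \<open>K\<close>, and by a
  further trace the constant function 1, would lie in \<open>W\<close>, although it lies in \<open>M\<close>. So \<open>P\<close> is
  a Sylow subgroup of \<open>K\<close>, and the Frattini argument gives \<open>G = N K\<close>. As \<open>N\<close> is a \<open>p\<close>-group in
  characteristic \<open>p\<close>, every nonzero \<open>N\<close>-stable space of functions on \<open>G / K\<close> contains a nonzero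
  \<open>N\<close>-fixed function, hence the constants; this forces \<open>M = k[G / K]\<close>.

  For a \<open>p\<close>-subgroup \<open>Q\<close> not contained in \<open>K\<close> the group \<open>Q\<close> fixes no point of \<open>G / K\<close> and
  \<open>M(Q) = 0\<close>. For \<open>Q \<le> K\<close> we have \<open>M(Q) = M\<close>, which is indecomposable over \<open>Q C(Q)\<close> once
  \<open>G = K C(Q)\<close>. Up to conjugation in \<open>K\<close> we may take \<open>Q \<le> P\<close>; the hypothesis on
  \<open>S(N, P) = k[N / P]\<close> then says precisely that \<open>N = P C\<^sub>N(Q)\<close>, since otherwise the functions supported
  on \<open>P C\<^sub>N(Q)\<close> and off it split \<open>k[N / P]\<close>.
\<close>

section \<open>Actions of p-groups and Sylow subgroups\<close>

text \<open>The points that are not fixed fall into orbits of length \<open>p ^ i\<close> with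
  \<open>i \<noteq> 0\<close>. The action is a bare function \<open>a\<close>, constrained only on
  \<open>E\<close>, so that cosets and functions can serve as points alike.\<close>

lemma (in group) p_dvd_card_nonfixed_points:
  assumes p: "prime p" and pgrp: "p_group_set p (carrier G)" and fin: "finite E"
    and closed: "\<And>g x. g \<in> carrier G \<Longrightarrow> x \<in> E \<Longrightarrow> a g x \<in> E"
    and one: "\<And>x. x \<in> E \<Longrightarrow> a \<one> x = x"
    and mult: "\<And>g h x. g \<in> carrier G \<Longrightarrow> h \<in> carrier G \<Longrightarrow> x \<in> E \<Longrightarrow> a (g \<otimes> h) x = a g (a h x)"
  shows "p dvd card (E - {x \<in> E. \<forall>g\<in>carrier G. a g x = x})"
proof -
  define F where "F = E - {x \<in> E. \<forall>g\<in>carrier G. a g x = x}"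
  \<comment> \<open>\<open>BijGroup F\<close> consists of extensional maps, hence the restriction to
    \<open>F\<close>.\<close>
  define \<phi> where "\<phi> = (\<lambda>g. \<lambda>x\<in>F. a g x)"
  have inv1: "a (inv g) (a g x) = x" if "g \<in> carrier G" "x \<in> E" for g x
    using that mult[of "inv g" g x] one by simp
  have inv2: "a g (a (inv g) x) = x" if "g \<in> carrier G" "x \<in> E" for g x
    using that mult[of g "inv g" x] one by simp
  have closedF: "a g x \<in> F" if "g \<in> carrier G" "x \<in> F" for g x
  proof -
    have "x \<in> E" using that F_def by auto
    moreover have "\<exists>h\<in>carrier G. a h (a g x) \<noteq> a g x"
    proof (rule ccontr)
      assume "\<not> ?thesis"
      then have *: "a h (a g x) = a g x" if "h \<in> carrier G" for h using that by blast
      have "a h x = x" if h: "h \<in> carrier G" for h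
      proof -
        \<comment> \<open>If every element fixes \<open>a g x\<close>, then so does
          \<open>g \<otimes> h \<otimes> inv g\<close>, and cancelling \<open>g\<close> shows that
          \<open>h\<close> fixes \<open>x\<close>.\<close>
        have "a (g \<otimes> h \<otimes> inv g) (a g x) = a g x" using * h \<open>g \<in> carrier G\<close> by simp
        then have "a g (a h x) = a g x"
          using mult[of "g \<otimes> h \<otimes> inv g" g x] mult[of g h x] h \<open>g \<in> carrier G\<close> \<open>x \<in> E\<close>
          by (simp add: m_assoc)
        then show ?thesis using inv1 closed h \<open>g \<in> carrier G\<close> \<open>x \<in> E\<close> by metis
      qed
      then show False using \<open>x \<in> F\<close> F_def by auto
    qed
    ultimately show ?thesis using closed that F_def by auto
  qed
  have FE: "F \<subseteq> E" using F_def by auto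
  have finF: "finite F" using FE fin finite_subset by blast
  have bij: "\<phi> g \<in> Bij F" if g: "g \<in> carrier G" for g
  proof -
    have "bij_betw (\<phi> g) F F"
      unfolding \<phi>_def
      by (rule bij_betwI[where g = "a (inv g)"]) (use g closedF inv1 inv2 FE in auto)
    then show ?thesis by (simp add: Bij_def \<phi>_def)
  qed
  interpret act: group_action G F \<phi>
  proof (unfold group_action_def group_hom_def group_hom_axioms_def, intro conjI)
    show "\<phi> \<in> hom G (BijGroup F)"
    proof (rule homI)
      show "\<phi> g \<in> carrier (BijGroup F)" if "g \<in> carrier G" for g
        using bij that by (simp add: BijGroup_def)
      show "\<phi> (g \<otimes> h) = \<phi> g \<otimes>\<^bsub>BijGroup F\<^esub> \<phi> h" if "g \<in> carrier G" "h \<in> carrier G" for g h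
        using that bij mult closedF FE
        by (auto simp: BijGroup_def compose_def \<phi>_def fun_eq_iff subset_iff)
    qed
  qed (auto simp: group_BijGroup)
  have "p dvd card Ob" if Ob: "Ob \<in> orbits G F \<phi>" for Ob
  proof -
    obtain x where x: "x \<in> F" "Ob = orbit G \<phi> x" using Ob by (auto simp: orbits_def)
    obtain n where "Coset.order G = p ^ n" using pgrp by (auto simp: p_group_set_def Coset.order_def)
    then have "card Ob dvd p ^ n"
      using act.orbit_stabilizer_theorem[OF x(1)] x(2) by (metis dvd_triv_left)
    then obtain i where i: "card Ob = p ^ i" using p by (auto simp: divides_primepow_nat)
    \<comment> \<open>An orbit of length one would be a fixed point, and those are excluded from
      \<open>F\<close>.\<close>
    have "i \<noteq> 0"
    proof
      assume "i = 0"
      then have "card Ob = 1" using i by simp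
      then have "Ob = {x}" using act.orbit_refl[OF x(1)] x(2) by (metis card_1_singletonE singletonD)
      then have "\<phi> g x = x" if "g \<in> carrier G" for g using that x(2) by (auto simp: orbit_def)
      then show False using x(1) by (auto simp: F_def \<phi>_def)
    qed
    then show ?thesis using i by simp
  qed
  moreover have "\<Union>(orbits G F \<phi>) = F" "\<forall>A\<in>orbits G F \<phi>. \<forall>B\<in>orbits G F \<phi>. A \<noteq> B \<longrightarrow> A \<inter> B = {}"
    using act.orbit_partition by (auto simp: partition_def) 
  ultimately have "p dvd card F"
    using dvd_partition[of "orbits G F \<phi>" p] finF by auto
  then show ?thesis by (simp add: F_def)
qed

lemma (in group) p_group_fixed_point_exists:
  assumes "prime p" "p_group_set p (carrier G)" "finite E"
    and "\<And>g x. g \<in> carrier G \<Longrightarrow> x \<in> E \<Longrightarrow> a g x \<in> E"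
    and "\<And>x. x \<in> E \<Longrightarrow> a \<one> x = x"
    and "\<And>g h x. g \<in> carrier G \<Longrightarrow> h \<in> carrier G \<Longrightarrow> x \<in> E \<Longrightarrow> a (g \<otimes> h) x = a g (a h x)"
    and "\<not> p dvd card E"
  shows "\<exists>x\<in>E. \<forall>g\<in>carrier G. a g x = x"
proof -
  have "p dvd card (E - {x \<in> E. \<forall>g\<in>carrier G. a g x = x})"
    by (rule p_dvd_card_nonfixed_points) (fact assms)+
  then have "E - {x \<in> E. \<forall>g\<in>carrier G. a g x = x} \<noteq> E"
    using assms(7) by auto
  then show ?thesis by blast
qed

section \<open>Cosets and conjugation into a subgroup of index prime to \<open>p\<close>\<close>

lemma (in group) left_cosets_eq_imp_mem:
  assumes "subgroup H G" "x \<in> carrier G" "y \<in> carrier G" "x <#\<^bsub>G\<^esub> H = y <#\<^bsub>G\<^esub> H"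
  shows "inv x \<otimes> y \<in> H"
  using assms lcos_self[of y H] subgroup.lcos_module_imp[OF assms(1) group_axioms, of x y] by simp

lemma (in group) left_cosets_eq_iff:
  assumes "subgroup H G" "x \<in> carrier G" "y \<in> carrier G"
  shows "x <#\<^bsub>G\<^esub> H = y <#\<^bsub>G\<^esub> H \<longleftrightarrow> inv x \<otimes> y \<in> H"
proof
  assume "inv x \<otimes> y \<in> H"
  then have "y \<in> x <#\<^bsub>G\<^esub> H" using assms by (intro subgroup.lcos_module_rev group_axioms)
  then show "x <#\<^bsub>G\<^esub> H = y <#\<^bsub>G\<^esub> H" using assms l_repr_independence by metis
qed (use assms left_cosets_eq_imp_mem in simp)

lemma (in group) card_left_cosets:
  assumes "finite (carrier G)" "subgroup Q G" "subgroup R G" "R \<subseteq> Q"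
  shows "card ((\<lambda>t. t <#\<^bsub>G\<^esub> R) ` Q) * card R = card Q"
proof -
  interpret Q: group "G\<lparr>carrier := Q\<rparr>" using assms subgroup_imp_group by blast
  have "(\<lambda>t. t <#\<^bsub>G\<^esub> R) ` Q = lcosets\<^bsub>G\<lparr>carrier := Q\<rparr>\<^esub> R"
    by (auto simp: LCOSETS_def)
  moreover have "finite Q" using assms finite_subset subgroup.subset by metis
  ultimately show ?thesis
    using Q.l_lagrange[of R] subgroup_incl[OF assms(3,2,4)] by (simp add: Coset.order_def)
qed

text \<open>Sylow's argument: \<open>Q\<close> acts on the cosets of \<open>P\<close> in
  \<open>K\<close> by left multiplication, and their number is prime to \<open>p\<close>. Some coset
  \<open>x P\<close> is therefore fixed by \<open>Q\<close>, which says that \<open>inv x\<close>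
  conjugates \<open>Q\<close> into \<open>P\<close>.\<close>

lemma (in group) p_subgroup_conjugate_into:
  assumes p: "prime p" and fin: "finite (carrier G)"
    and K: "subgroup K G" and P: "subgroup P G" "P \<subseteq> K"
    and index: "\<not> p dvd card ((\<lambda>t. t <#\<^bsub>G\<^esub> P) ` K)"
    and Q: "p_subgroup G p Q" "Q \<subseteq> K"
  obtains x where "x \<in> K" "\<And>q. q \<in> Q \<Longrightarrow> inv x \<otimes> q \<otimes> x \<in> P"
proof -
  have subs: "K \<subseteq> carrier G" "P \<subseteq> carrier G" "Q \<subseteq> carrier G"
    using subgroup.subset K P(1) Q(1) unfolding p_subgroup_def by blast+
  interpret Q: group "G\<lparr>carrier := Q\<rparr>" using Q subgroup_imp_group by (auto simp: p_subgroup_def)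
  have finE: "finite ((\<lambda>t. t <#\<^bsub>G\<^esub> P) ` K)" using subs fin finite_subset by blast
  have "\<exists>C\<in>(\<lambda>t. t <#\<^bsub>G\<^esub> P) ` K. \<forall>g\<in>carrier (G\<lparr>carrier := Q\<rparr>). g <#\<^bsub>G\<^esub> C = C"
  proof (rule Q.p_group_fixed_point_exists[OF p _ finE _ _ _ index])
    show "p_group_set p (carrier (G\<lparr>carrier := Q\<rparr>))" using Q by (simp add: p_subgroup_def)
    show "g <#\<^bsub>G\<^esub> C \<in> (\<lambda>t. t <#\<^bsub>G\<^esub> P) ` K"
      if "g \<in> carrier (G\<lparr>carrier := Q\<rparr>)" "C \<in> (\<lambda>t. t <#\<^bsub>G\<^esub> P) ` K" for g C
      using that subs Q K by (auto simp: lcos_m_assoc subset_iff intro!: imageI subgroup.m_closed)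
    show "\<one>\<^bsub>G\<lparr>carrier := Q\<rparr>\<^esub> <#\<^bsub>G\<^esub> C = C" if "C \<in> (\<lambda>t. t <#\<^bsub>G\<^esub> P) ` K" for C
      using that subs by (auto simp: lcos_mult_one l_coset_subset_G subset_iff lcos_m_assoc)
    show "(g \<otimes>\<^bsub>G\<lparr>carrier := Q\<rparr>\<^esub> h) <#\<^bsub>G\<^esub> C = g <#\<^bsub>G\<^esub> (h <#\<^bsub>G\<^esub> C)"
      if "g \<in> carrier (G\<lparr>carrier := Q\<rparr>)" "h \<in> carrier (G\<lparr>carrier := Q\<rparr>)"
        "C \<in> (\<lambda>t. t <#\<^bsub>G\<^esub> P) ` K" for g h C
      using that subs by (auto simp: lcos_m_assoc subset_iff m_assoc)
  qed
  then obtain C where C: "C \<in> (\<lambda>t. t <#\<^bsub>G\<^esub> P) ` K" "\<And>g. g \<in> Q \<Longrightarrow> g <#\<^bsub>G\<^esub> C = C"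
    by auto
  obtain x where x: "x \<in> K" "C = x <#\<^bsub>G\<^esub> P" using C by auto
  have "inv x \<otimes> q \<otimes> x \<in> P" if "q \<in> Q" for q
  proof -
    have c: "q \<in> carrier G" "x \<in> carrier G" using that x subs by auto
    then have "x <#\<^bsub>G\<^esub> P = (q \<otimes> x) <#\<^bsub>G\<^esub> P" using C(2)[OF that] x subs by (simp add: lcos_m_assoc)
    then show ?thesis using left_cosets_eq_imp_mem[OF P(1), of x "q \<otimes> x"] c by (simp add: m_assoc)
  qed
  then show thesis using that x by blast
qed

section \<open>Normalizers and the Frattini argument\<close>

lemma (in group) mem_normalizer_iff:
  assumes "subgroup P G"
  shows "g \<in> normalizer G P \<longleftrightarrow> g \<in> carrier G \<and> (\<lambda>x. g \<otimes> x \<otimes> inv g) ` P = P"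
proof -
  have "g <#\<^bsub>G\<^esub> P #> inv g = (\<lambda>x. g \<otimes> x \<otimes> inv g) ` P"
    by (auto simp: l_coset_def r_coset_def)
  then show ?thesis
    using subgroup.subset[OF assms] by (simp add: normalizer_def stabilizer_def)
qed

lemma (in group) subgroup_normalizer:
  assumes "subgroup P G"
  shows "subgroup (normalizer G P) G"
proof -
  interpret act: group_action G "{H. H \<subseteq> carrier G}"
    "\<lambda>g. \<lambda>H \<in> {H. H \<subseteq> carrier G}. g <#\<^bsub>G\<^esub> H #> (inv g)"
    by (rule action_by_conjugation_on_power_set)
  show ?thesis unfolding normalizer_def
    by (rule act.stabilizer_subgroup) (use assms subgroup.subset in blast)
qed

text \<open>Conjugation is injective, so for finite \<open>P\<close> mapping into \<open>P\<close>
  already means mapping onto it.\<close>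

lemma (in group) conj_into_imp_mem_normalizer:
  assumes "subgroup P G" "finite P" "g \<in> carrier G" "\<And>x. x \<in> P \<Longrightarrow> g \<otimes> x \<otimes> inv g \<in> P"
  shows "g \<in> normalizer G P"
proof -
  have "inj_on (\<lambda>x. g \<otimes> x \<otimes> inv g) P"
    using subgroup.subset[OF assms(1)] assms(3) by (auto simp: inj_on_def subset_iff)
  then have "(\<lambda>x. g \<otimes> x \<otimes> inv g) ` P = P"
    using assms by (intro card_subset_eq) (auto simp: card_image)
  then show ?thesis using assms mem_normalizer_iff[OF assms(1)] by blast
qed

lemma (in group) normalizer_conj_closed:
  assumes "subgroup P G" "g \<in> normalizer G P" "x \<in> P"
  shows "g \<otimes> x \<otimes> inv g \<in> P"
  using assms mem_normalizer_iff[OF assms(1)] by blast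

lemma (in group) subgroup_subset_normalizer:
  assumes "subgroup P G" "finite P"
  shows "P \<subseteq> normalizer G P"
proof
  fix g assume "g \<in> P"
  then show "g \<in> normalizer G P"
    using assms subgroupE(3,4)[OF assms(1)] subgroup.mem_carrier[OF assms(1)]
    by (intro conj_into_imp_mem_normalizer) auto
qed

lemma (in group) p_subgroup_conj:
  assumes "p_subgroup G p P" "g \<in> carrier G"
  shows "p_subgroup G p (g <#\<^bsub>G\<^esub> P #> inv g)"
proof -
  have P: "subgroup P G" "P \<subseteq> carrier G" using assms subgroup.subset by (auto simp: p_subgroup_def)
  have "g <#\<^bsub>G\<^esub> P #> inv g = (\<lambda>x. g \<otimes> x \<otimes> inv g) ` P"
    by (auto simp: l_coset_def r_coset_def)
  moreover have "inj_on (\<lambda>x. g \<otimes> x \<otimes> inv g) P"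
    using P(2) assms(2) by (auto simp: inj_on_def subset_iff)
  ultimately have "card (g <#\<^bsub>G\<^esub> P #> inv g) = card P" "finite (g <#\<^bsub>G\<^esub> P #> inv g) = finite P"
    by (auto simp: card_image finite_image_iff)
  then show ?thesis
    using assms subgroup_conjugation_is_surj2[OF assms(2) P(1)]
    by (auto simp: p_subgroup_def p_group_set_def)
qed

text \<open>Normality of \<open>K\<close> puts the conjugate of \<open>P\<close> by
  \<open>inv g\<close> inside \<open>K\<close>. An element \<open>x\<close> of \<open>K\<close>
  moves it back into \<open>P\<close>, so \<open>inv x \<otimes> inv g\<close> normalizes
  \<open>P\<close>, and \<open>g\<close> differs from a normalizing element by a factor in
  \<open>K\<close>.\<close>

lemma (in group) frattini_argument:
  assumes p: "prime p" and fin: "finite (carrier G)"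
    and K: "K \<lhd> G" and P: "p_subgroup G p P" "P \<subseteq> K"
    and index: "\<not> p dvd card ((\<lambda>t. t <#\<^bsub>G\<^esub> P) ` K)"
    and g: "g \<in> carrier G"
  obtains n k where "n \<in> normalizer G P" "k \<in> K" "g = n \<otimes> k"
proof -
  interpret K: normal K G by (rule K)
  have Ps: "subgroup P G" "P \<subseteq> carrier G" using P subgroup.subset by (auto simp: p_subgroup_def)
  have sub: "inv g <#\<^bsub>G\<^esub> P #> inv (inv g) \<subseteq> K"
    using P(2) K.inv_op_closed1[OF g] g Ps(2) by (auto simp: l_coset_def r_coset_def subset_iff)
  obtain x where x: "x \<in> K"
    "\<And>q. q \<in> inv g <#\<^bsub>G\<^esub> P #> inv (inv g) \<Longrightarrow> inv x \<otimes> q \<otimes> x \<in> P"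
    using p_subgroup_conjugate_into[OF p fin K.subgroup_axioms Ps(1) P(2) index
        p_subgroup_conj[OF P(1) inv_closed[OF g]] sub] by blast
  have xG: "x \<in> carrier G" using x(1) K.subset by blast
  define n where "n = inv x \<otimes> inv g"
  have n: "n \<in> carrier G" using xG g n_def by simp
  have "n \<in> normalizer G P"
  proof (rule conj_into_imp_mem_normalizer[OF Ps(1) _ n])
    show "finite P" using fin Ps finite_subset by blast
    fix y assume y: "y \<in> P"
    then have "inv x \<otimes> (inv g \<otimes> y \<otimes> inv (inv g)) \<otimes> x \<in> P"
      by (intro x) (auto simp: l_coset_def r_coset_def)
    moreover have "y \<in> carrier G" using y Ps by blast
    ultimately show "n \<otimes> y \<otimes> inv n \<in> P" using xG g by (simp add: n_def m_assoc inv_mult_group)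
  qed
  then have "inv n \<in> normalizer G P"
    by (rule subgroup.m_inv_closed[OF subgroup_normalizer[OF Ps(1)]])
  moreover have "g = inv n \<otimes> inv x" using xG g by (simp add: n_def m_assoc inv_mult_group)
  ultimately show thesis using that K.m_inv_closed[OF x(1)] by blast
qed

section \<open>Permutation modules on cosets\<close>

lemma fsubspaceD:
  assumes "fsubspace V"
  shows fsubspace_zero: "(\<lambda>_. 0) \<in> V"
    and fsubspace_add: "v \<in> V \<Longrightarrow> w \<in> V \<Longrightarrow> (\<lambda>x. v x + w x) \<in> V"
    and fsubspace_scale: "v \<in> V \<Longrightarrow> (\<lambda>x. c * v x) \<in> V"
  using assms by (auto simp: fsubspace_def)

lemma fsubspace_diff:
  assumes "fsubspace V" "v \<in> V" "w \<in> V"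
  shows "(\<lambda>x. v x - w x) \<in> V"
  using fsubspace_add[OF assms(1,2) fsubspace_scale[OF assms(1,3), of "-1"]] by simp

lemma fsubspace_sum:
  assumes "fsubspace V" "\<And>i. i \<in> I \<Longrightarrow> f i \<in> V"
  shows "(\<lambda>x. \<Sum>i\<in>I. f i x) \<in> V"
  using assms(2)
  by (induction I rule: infinite_finite_induct)
    (auto intro: fsubspace_zero[OF assms(1)] fsubspace_add[OF assms(1)])

lemma fsubspace_Int: "fsubspace V \<Longrightarrow> fsubspace W \<Longrightarrow> fsubspace (V \<inter> W)"
  by (auto simp: fsubspace_def)

lemma ind_spaceI:
  assumes "\<And>x. x \<notin> carrier G \<Longrightarrow> f x = 0"
    and "\<And>x h. x \<in> carrier G \<Longrightarrow> h \<in> H \<Longrightarrow> f (x \<otimes>\<^bsub>G\<^esub> h) = f x"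
  shows "f \<in> ind_space G H"
  using assms by (auto simp: ind_space_def)

lemma ind_space_outside: "f \<in> ind_space G H \<Longrightarrow> x \<notin> carrier G \<Longrightarrow> f x = 0"
  by (simp add: ind_space_def)

lemma ind_space_right_invariant:
  "f \<in> ind_space G H \<Longrightarrow> x \<in> carrier G \<Longrightarrow> h \<in> H \<Longrightarrow> f (x \<otimes>\<^bsub>G\<^esub> h) = f x"
  by (simp add: ind_space_def)

lemma fsubspace_ind_space: "fsubspace (ind_space G H)"
  by (auto simp: fsubspace_def ind_space_def)

lemma ind_action_zero [simp]: "ind_action G g (\<lambda>_. 0) = (\<lambda>_. 0)"
  by (simp add: ind_action_def fun_eq_iff)

lemma (in group) ind_action_mult:
  assumes "g \<in> carrier G" "h \<in> carrier G"
  shows "ind_action G (g \<otimes> h) f = ind_action G g (ind_action G h f)"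
  using assms by (auto simp: ind_action_def fun_eq_iff inv_mult_group m_assoc)

lemma (in group) ind_action_one: "f \<in> ind_space G H \<Longrightarrow> ind_action G \<one> f = f"
  by (auto simp: ind_action_def fun_eq_iff ind_space_outside)

lemma (in group) stable_ind_space:
  assumes "subgroup H G"
  shows "stable_sub (carrier G) (ind_action G) (ind_space G H) (ind_space G H)"
  using subgroup.subset[OF assms] fsubspace_ind_space[of G H]
  by (auto simp: stable_sub_def ind_space_def ind_action_def m_assoc[symmetric] subset_iff)

text \<open>By normality \<open>inv h \<otimes> x\<close> is \<open>x\<close> times a conjugate of
  \<open>inv h\<close>, again in \<open>H\<close>, and \<open>f\<close> is constant on
  \<open>x H\<close>.\<close>

lemma (in normal) ind_action_trivial:
  assumes "f \<in> ind_space G H" "h \<in> H"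
  shows "ind_action G h f = f"
proof
  fix x
  show "ind_action G h f x = f x"
  proof (cases "x \<in> carrier G")
    case True
    have "h \<in> carrier G" using assms by simp
    then have "inv h \<otimes> x = x \<otimes> (inv x \<otimes> inv h \<otimes> x)" using True by (simp add: m_assoc[symmetric])
    moreover have "inv x \<otimes> inv h \<otimes> x \<in> H" using True assms by (simp add: inv_op_closed1)
    ultimately show ?thesis
      using ind_space_right_invariant[OF assms(1) True] True by (simp add: ind_action_def)
  qed (use assms ind_space_outside in \<open>auto simp: ind_action_def\<close>)
qed

text \<open>The value at \<open>n \<otimes> h\<close> equals the value at \<open>n\<close> by right
  invariance, and then the value at \<open>\<one>\<close> by invariance under
  \<open>n\<close>.\<close>

lemma (in group) indicator_carrier_eq_of_fixed:
  assumes "v \<in> ind_space G H" "N \<subseteq> carrier G" "\<And>g. g \<in> carrier G \<Longrightarrow> \<exists>n\<in>N. \<exists>h\<in>H. g = n \<otimes> h"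
    and "\<And>n. n \<in> N \<Longrightarrow> ind_action G n v = v"
  shows "v = (\<lambda>x. v \<one> * indicator (carrier G) x)"
proof
  fix x
  show "v x = v \<one> * indicator (carrier G) x"
  proof (cases "x \<in> carrier G")
    case True
    then obtain n h where n: "n \<in> N" "h \<in> H" "n \<in> carrier G" "x = n \<otimes> h"
      using assms(2,3) by blast
    then have "v x = v n" using ind_space_right_invariant[OF assms(1)] by simp
    also have "\<dots> = ind_action G n v n" using assms(4) n by simp
    also have "\<dots> = v \<one>" using n by (simp add: ind_action_def)
    finally show ?thesis using True by simp
  qed (use assms ind_space_outside in auto)
qed

lemma (in group) indicator_mem_of_fixed:
  fixes W :: "('a \<Rightarrow> 'k::field) set"
  assumes W: "fsubspace W" "W \<subseteq> ind_space G H" and v: "v \<in> W" "v \<noteq> (\<lambda>_. 0)"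
    and "N \<subseteq> carrier G" "\<And>g. g \<in> carrier G \<Longrightarrow> \<exists>n\<in>N. \<exists>h\<in>H. g = n \<otimes> h"
    and "\<And>n. n \<in> N \<Longrightarrow> ind_action G n v = v"
  shows "indicator (carrier G) \<in> W"
proof -
  have "v \<in> ind_space G H" using W(2) v(1) by blast
  then have "v = (\<lambda>x. v \<one> * indicator (carrier G) x)"
    using assms(5-7) by (rule indicator_carrier_eq_of_fixed)
  then obtain c where eq: "v = (\<lambda>x. c * indicator (carrier G) x)" by blast
  then have "c \<noteq> 0" using v(2) by auto
  then have "(\<lambda>x. inverse c * v x) = indicator (carrier G)"
    unfolding eq by (simp add: mult.assoc[symmetric])
  then show ?thesis using fsubspace_scale[OF W(1) v(1), of "inverse c"] by simp
qed

section \<open>Fixed vectors of p-groups in characteristic \<open>p\<close>\<close>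

lemma of_nat_mod_CHAR: "of_nat (i mod CHAR('k)) = (of_nat i :: 'k::field)"
proof -
  have "(of_nat i :: 'k) = of_nat (CHAR('k) * (i div CHAR('k)) + i mod CHAR('k))"
    by (simp only: mult_div_mod_eq)
  also have "\<dots> = of_nat (i mod CHAR('k))"
    by (simp only: of_nat_add of_nat_mult of_nat_CHAR mult_zero_left add_0_left)
  finally show ?thesis by simp
qed

text \<open>Translation by multiples of \<open>w\<close> partitions \<open>A\<close> into lines,
  each a coset of the additive group generated by \<open>w\<close>, which has
  \<open>CHAR('k)\<close> elements.\<close>

lemma CHAR_dvd_card_additive:
  fixes A :: "('x \<Rightarrow> 'k::field) set"
  assumes fin: "finite A" and prime: "prime CHAR('k)" and w: "w \<in> A" "w \<noteq> (\<lambda>_. 0)"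
    and add: "\<And>a b. a \<in> A \<Longrightarrow> b \<in> A \<Longrightarrow> (\<lambda>x. a x + b x) \<in> A"
  shows "CHAR('k) dvd card A"
proof -
  let ?p = "CHAR('k)"
  have p0: "?p > 0" using prime prime_gt_0_nat by blast
  \<comment> \<open>All natural multiples are allowed, which makes lines easy to compare;
    \<open>line_eq\<close> cuts the range down to \<open>{..<?p}\<close> for counting.\<close>
  define line where "line a = range (\<lambda>i::nat. \<lambda>x. a x + of_nat i * w x)" for a
  have line_sub: "line a \<subseteq> A" if "a \<in> A" for a
  proof -
    have "(\<lambda>x. a x + of_nat i * w x) \<in> A" for i
    proof (induction i)
      case (Suc i)
      then show ?case using add[OF Suc w(1)] by (simp add: algebra_simps)
    qed (use that in simp)
    then show ?thesis by (auto simp: line_def)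
  qed
  have line_eq: "line a = (\<lambda>i. \<lambda>x. a x + of_nat i * w x) ` {..<?p}" for a
  proof
    show "line a \<subseteq> (\<lambda>i. \<lambda>x. a x + of_nat i * w x) ` {..<?p}"
    proof
      fix b assume "b \<in> line a"
      then obtain i where "b = (\<lambda>x. a x + of_nat i * w x)" by (auto simp: line_def)
      then have "b = (\<lambda>x. a x + of_nat (i mod ?p) * w x)" by (simp only: of_nat_mod_CHAR)
      then show "b \<in> (\<lambda>i. \<lambda>x. a x + of_nat i * w x) ` {..<?p}" using p0 by (auto intro!: image_eqI)
    qed
  qed (auto simp: line_def)
  obtain y where y: "w y \<noteq> 0" using w by auto
  have "card (line a) = ?p" for a
  proof -
    have "inj_on (\<lambda>i. \<lambda>x. a x + of_nat i * w x) {..<?p}"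
    proof (rule linorder_inj_onI)
      fix i j assume ij: "i < j" "i \<in> {..<?p}" "j \<in> {..<?p}"
      show "(\<lambda>x. a x + of_nat i * w x) \<noteq> (\<lambda>x. a x + of_nat j * w x)"
      proof
        assume "(\<lambda>x. a x + of_nat i * w x) = (\<lambda>x. a x + of_nat j * w x)"
        then have "a y + of_nat i * w y = a y + of_nat j * w y" by metis
        then have "(of_nat i :: 'k) = of_nat j" using y by simp
        then have "(of_nat (j - i) :: 'k) = 0" using ij by (simp add: of_nat_diff)
        then have "?p dvd j - i" by (simp add: of_nat_eq_0_iff_char_dvd)
        then show False using ij by (auto dest: dvd_imp_le)
      qed
    qed auto
    then show ?thesis by (simp add: line_eq card_image)
  qed
  moreover have "\<Union>(line ` A) = A"
  proof
    show "A \<subseteq> \<Union>(line ` A)"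
    proof
      fix a assume "a \<in> A"
      moreover have "a \<in> line a" by (auto simp: line_def intro!: image_eqI[where x = 0])
      ultimately show "a \<in> \<Union>(line ` A)" by blast
    qed
  qed (use line_sub in blast)
  moreover have "line a \<inter> line b = {}" if "line a \<noteq> line b" for a b
  proof (rule ccontr)
    assume "line a \<inter> line b \<noteq> {}"
    then obtain i j where ij: "(\<lambda>x. a x + of_nat i * w x) = (\<lambda>x. b x + of_nat j * w x)"
      by (auto simp: line_def)
    have "line a \<subseteq> line b"
      if "(\<lambda>x. a x + of_nat i * w x) = (\<lambda>x. b x + of_nat j * w x)" for a b i j
    proof
      fix c assume "c \<in> line a"
      then obtain l where c: "c = (\<lambda>x. a x + of_nat l * w x)" by (auto simp: line_def)
      \<comment> \<open>The multiple \<open>?p - 1\<close> stands in for \<open>-1\<close>, so that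
        subtraction stays within natural coefficients.\<close>
      have neg: "of_nat ((?p - 1) * i) = (- of_nat i :: 'k)"
        using p0 by (simp add: of_nat_diff Suc_leI)
      have "a = (\<lambda>x. b x + of_nat j * w x - of_nat i * w x)"
        by (rule ext) (use fun_cong[OF that] in \<open>simp add: eq_diff_eq\<close>)
      then have "c = (\<lambda>x. b x + of_nat (j + (?p - 1) * i + l) * w x)"
        unfolding c of_nat_add neg by (simp add: algebra_simps)
      then show "c \<in> line b" unfolding line_def by blast
    qed
    from this[OF ij] this[OF ij[symmetric]] show False using that by blast
  qed
  ultimately show ?thesis
    using dvd_partition[of "line ` A" ?p] fin by auto
qed

text \<open>The field may be infinite, so the orbit count runs in the finite set \<open>A\<close> of
  prime-field combinations of the translates of one nonzero \<open>w\<close>. The size of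
  \<open>A\<close> is divisible by \<open>p\<close>; without zero it is not, so \<open>N\<close>
  fixes a nonzero point.\<close>

lemma (in group) p_subgroup_fixed_vector:
  fixes W :: "('a \<Rightarrow> 'k::field) set"
  assumes p: "prime p" and char: "CHAR('k) = p" and N: "p_subgroup G p N"
    and W: "stable_sub N (ind_action G) (ind_space G H) W" and nz: "W \<noteq> {\<lambda>_. 0}"
  shows "\<exists>v\<in>W. v \<noteq> (\<lambda>_. 0) \<and> (\<forall>n\<in>N. ind_action G n v = v)"
proof -
  have Wsub: "fsubspace W" and WI: "W \<subseteq> ind_space G H"
    and stab: "\<And>n w. n \<in> N \<Longrightarrow> w \<in> W \<Longrightarrow> ind_action G n w \<in> W"
    using W by (auto simp: stable_sub_def)
  have Ns: "subgroup N G" "finite N" using N by (auto simp: p_subgroup_def p_group_set_def)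
  have NG: "N \<subseteq> carrier G" using Ns subgroup.subset by blast
  obtain w where w: "w \<in> W" "w \<noteq> (\<lambda>_. 0)" using nz fsubspace_zero[OF Wsub] by blast
  \<comment> \<open>Natural coefficients stand for elements of the prime field; reduced mod
    \<open>p\<close> they leave only finitely many combinations.\<close>
  define comb where
    "comb c = (\<lambda>x. \<Sum>g\<in>N. of_nat (c g) * ind_action G g w x)" for c :: "'a \<Rightarrow> nat"
  define A where "A = range comb"
  have p0: "p > 0" using p prime_gt_0_nat by blast
  have mod: "of_nat (i mod p) = (of_nat i :: 'k)" for i
    using of_nat_mod_CHAR[of i, where 'k = 'k] by (simp add: char)
  have "A \<subseteq> comb ` (N \<rightarrow>\<^sub>E {..<p})"
  proof
    fix a assume "a \<in> A"
    then obtain c where "a = comb c" by (auto simp: A_def)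
    then have "a = comb (\<lambda>g\<in>N. c g mod p)" by (simp add: comb_def mod)
    then show "a \<in> comb ` (N \<rightarrow>\<^sub>E {..<p})" using p0 by (auto intro!: image_eqI)
  qed
  then have finA: "finite A" by (rule finite_subset) (simp add: Ns finite_PiE)
  have AW: "A \<subseteq> W"
    unfolding A_def comb_def
    using stab w by (auto intro!: fsubspace_sum[OF Wsub] fsubspace_scale[OF Wsub])
  have wA: "w \<in> A"
  proof -
    have "comb (\<lambda>g. if g = \<one> then 1 else 0) = ind_action G \<one> w"
      using Ns subgroup.one_closed[OF Ns(1)]
      by (simp add: comb_def if_distrib[of of_nat] if_distrib[of "\<lambda>z. z * _"] cong: if_cong)
    also have "\<dots> = w" using w WI by (intro ind_action_one) auto
    finally show ?thesis by (metis A_def rangeI)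
  qed
  have add: "(\<lambda>x. a x + b x) \<in> A" if "a \<in> A" "b \<in> A" for a b
  proof -
    obtain c d where "a = comb c" "b = comb d" using \<open>a \<in> A\<close> \<open>b \<in> A\<close> by (auto simp: A_def)
    then have "(\<lambda>x. a x + b x) = comb (\<lambda>g. c g + d g)"
      by (simp add: comb_def sum.distrib algebra_simps)
    then show ?thesis by (auto simp: A_def)
  qed
  have zero: "(\<lambda>_. 0) \<in> A"
  proof -
    have "comb (\<lambda>_. 0) = (\<lambda>_. 0)" by (simp add: comb_def)
    then show ?thesis by (metis A_def rangeI)
  qed
  have act: "ind_action G h a \<in> A" if h: "h \<in> N" and "a \<in> A" for h a
  proof -
    obtain c where a: "a = comb c" using \<open>a \<in> A\<close> by (auto simp: A_def)
    have "ind_action G h a = (\<lambda>x. \<Sum>g\<in>N. of_nat (c g) * ind_action G (h \<otimes> g) w x)"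
    proof
      fix x
      show "ind_action G h a x = (\<Sum>g\<in>N. of_nat (c g) * ind_action G (h \<otimes> g) w x)"
        using h NG by (auto simp: a comb_def ind_action_mult subset_iff ind_action_def[of G h])
    qed
    \<comment> \<open>Left multiplication by \<open>h\<close> permutes \<open>N\<close>, so it only
      shifts the coefficients.\<close>
    also have "\<dots> = comb (\<lambda>g. c (inv h \<otimes> g))"
    proof
      fix x
      have "(\<Sum>g\<in>N. of_nat (c g) * ind_action G (h \<otimes> g) w x) =
        (\<Sum>g\<in>N. of_nat (c (inv h \<otimes> g)) * ind_action G g w x)"
        by (rule sum.reindex_bij_witness[where i = "\<lambda>g. inv h \<otimes> g" and j = "\<lambda>g. h \<otimes> g"])
          (use h NG subgroupE(3,4)[OF Ns(1)] in \<open>auto simp: m_assoc[symmetric] subset_iff\<close>)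
      then show "(\<Sum>g\<in>N. of_nat (c g) * ind_action G (h \<otimes> g) w x) = comb (\<lambda>g. c (inv h \<otimes> g)) x"
        by (simp add: comb_def)
    qed
    finally show ?thesis by (auto simp: A_def)
  qed
  \<comment> \<open>With this, \<open>N\<close> acts on \<open>A - {\<lambda>_. 0}\<close>:
    translating back by \<open>inv h\<close> recovers \<open>a\<close>.\<close>
  have inj0: "ind_action G h a \<noteq> (\<lambda>_. 0)" if h: "h \<in> N" "a \<in> A" "a \<noteq> (\<lambda>_. 0)" for h a
  proof
    assume "ind_action G h a = (\<lambda>_. 0)"
    then have "ind_action G (inv h \<otimes> h) a = (\<lambda>_. 0)"
      using h NG by (subst ind_action_mult) auto
    moreover have "ind_action G (inv h \<otimes> h) a = a"
      using h NG AW WI ind_action_one[of a H] by (auto simp: subset_iff)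
    ultimately show False using h by simp
  qed
  have "p dvd card A"
    unfolding char[symmetric]
    by (rule CHAR_dvd_card_additive[OF finA _ wA w(2)]) (simp_all only: char p add)
  \<comment> \<open>Zero is one element of \<open>A\<close>, so \<open>p\<close> cannot divide both
    \<open>card A\<close> and the number of nonzero elements.\<close>
  moreover have "card A = Suc (card (A - {\<lambda>_. 0}))"
    by (rule card.remove[OF finA zero])
  ultimately have ndvd: "\<not> p dvd card (A - {\<lambda>_. 0})"
    using p by (metis One_nat_def Suc_eq_plus1 dvd_add_right_iff not_prime_unit)
  interpret N: group "G\<lparr>carrier := N\<rparr>" using Ns subgroup_imp_group by blast
  have "\<exists>v\<in>A - {\<lambda>_. 0}. \<forall>n\<in>carrier (G\<lparr>carrier := N\<rparr>). ind_action G n v = v"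
  proof (rule N.p_group_fixed_point_exists[OF p _ _ _ _ _ ndvd])
    show "p_group_set p (carrier (G\<lparr>carrier := N\<rparr>))" using N by (simp add: p_subgroup_def)
    show "ind_action G \<one>\<^bsub>G\<lparr>carrier := N\<rparr>\<^esub> v = v" if "v \<in> A - {\<lambda>_. 0}" for v
      using that AW WI ind_action_one[of v H] by auto
    show "ind_action G (g \<otimes>\<^bsub>G\<lparr>carrier := N\<rparr>\<^esub> h) v = ind_action G g (ind_action G h v)"
      if "g \<in> carrier (G\<lparr>carrier := N\<rparr>)" "h \<in> carrier (G\<lparr>carrier := N\<rparr>)" for g h v
      using that NG by (auto intro: ind_action_mult)
  qed (use finA act inj0 in auto)
  then show ?thesis using AW by auto
qed

text \<open>A nonzero \<open>N\<close>-fixed vector exists, and \<open>cover\<close> makes it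
  constant on \<open>G\<close>. Hence any two nonzero \<open>N\<close>-stable subspaces intersect
  nontrivially, which is how indecomposability is shown below.\<close>

lemma (in group) indicator_mem_stable_sub:
  fixes W :: "('a \<Rightarrow> 'k::field) set"
  assumes "prime p" "CHAR('k) = p" and N: "p_subgroup G p N"
    and W: "stable_sub N (ind_action G) (ind_space G H) W" and "W \<noteq> {\<lambda>_. 0}"
    and cover: "\<And>g. g \<in> carrier G \<Longrightarrow> \<exists>n\<in>N. \<exists>h\<in>H. g = n \<otimes> h"
  shows "indicator (carrier G) \<in> W"
proof -
  obtain v where v: "v \<in> W" "v \<noteq> (\<lambda>_. 0)" "\<And>n. n \<in> N \<Longrightarrow> ind_action G n v = v"
    using p_subgroup_fixed_vector[OF assms(1-5)] by blast
  show ?thesis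
    by (rule indicator_mem_of_fixed[OF _ _ v(1,2) _ cover v(3)])
      (use W N subgroup.subset in \<open>auto simp: stable_sub_def p_subgroup_def\<close>)
qed

section \<open>Relative traces and the Brauer construction\<close>

text \<open>\<open>rel_trace\<close> picks its coset representatives by \<open>SOME\<close>; these
  are the two facts about them that computing a trace requires.\<close>

lemma (in group) coset_representative:
  assumes "subgroup Q G" "subgroup R G" "R \<subseteq> Q" "C \<in> (\<lambda>t. t <#\<^bsub>G\<^esub> R) ` Q"
  shows "(SOME t. t \<in> C) \<in> Q" "(SOME t. t \<in> C) <#\<^bsub>G\<^esub> R = C"
proof -
  obtain t where t: "t \<in> Q" "C = t <#\<^bsub>G\<^esub> R" using assms by auto
  have tG: "t \<in> carrier G" using t subgroup.mem_carrier[OF assms(1)] by blast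
  have "t \<in> C" using lcos_self[OF tG assms(2)] t by simp
  then have mem: "(SOME t. t \<in> C) \<in> C" by (rule someI)
  then show "(SOME t. t \<in> C) \<in> Q"
    using t assms(3) subgroup.m_closed[OF assms(1)] by (auto simp: l_coset_def)
  show "(SOME t. t \<in> C) <#\<^bsub>G\<^esub> R = C"
    using l_repr_independence[OF _ tG assms(2)] mem t(2) by metis
qed

lemma (in group) rel_trace_of_fixed:
  assumes "subgroup Q G" "subgroup R G" "R \<subseteq> Q" "\<And>q. q \<in> Q \<Longrightarrow> \<rho> q v = v"
  shows "rel_trace G Q R \<rho> v = (\<lambda>x. of_nat (card ((\<lambda>t. t <#\<^bsub>G\<^esub> R) ` Q)) * v x)"
proof -
  have "\<rho> (SOME t. t \<in> C) v = v" if "C \<in> (\<lambda>t. t <#\<^bsub>G\<^esub> R) ` Q" for C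
    using coset_representative[OF assms(1-3) that] assms(4) by blast
  then show ?thesis by (simp add: rel_trace_def)
qed

lemma (in group) rel_trace_mem:
  assumes "subgroup Q G" "subgroup R G" "R \<subseteq> Q" "stable_sub Q \<rho> V W" "v \<in> W"
  shows "rel_trace G Q R \<rho> v \<in> W"
  unfolding rel_trace_def
  by (rule fsubspace_sum) (use assms coset_representative(1)[OF assms(1-3)] in \<open>auto simp: stable_sub_def\<close>)

lemma rel_trace_ind_action_zero [simp]: "rel_trace G Q R (ind_action G) (\<lambda>_. 0) = (\<lambda>_. 0)"
  by (simp add: rel_trace_def)

lemma rel_trace_ind_action_add:
  "rel_trace G Q R (ind_action G) (\<lambda>x. v x + w x) =
    (\<lambda>x. rel_trace G Q R (ind_action G) v x + rel_trace G Q R (ind_action G) w x)"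
proof -
  have "ind_action G g (\<lambda>x. v x + w x) x = ind_action G g v x + ind_action G g w x" for g x
    by (simp add: ind_action_def)
  then show ?thesis by (simp add: rel_trace_def sum.distrib)
qed

text \<open>The trace at \<open>x\<close> sums \<open>f (inv t \<otimes> x)\<close> over
  representatives \<open>t\<close> of the cosets of \<open>R\<close> in \<open>Q\<close>, and only
  the coset of \<open>q\<close> contributes. Since the chosen representatives are unknown,
  \<open>f\<close> is prescribed for every \<open>t\<close> in \<open>Q\<close>.\<close>

lemma (in group) rel_trace_apply_single_coset:
  assumes Q: "finite Q" "subgroup Q G" and R: "subgroup R G" "R \<subseteq> Q"
    and x: "x \<in> carrier G" and q: "q \<in> Q"
    and f: "\<And>t. t \<in> Q \<Longrightarrow> f (inv t \<otimes> x) = (if inv t \<otimes> q \<in> R then c else 0)"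
  shows "rel_trace G Q R (ind_action G) f x = c"
proof -
  let ?S = "(\<lambda>t. t <#\<^bsub>G\<^esub> R) ` Q"
  have qG: "q \<in> carrier G" using q subgroup.mem_carrier[OF Q(2)] by blast
  have "ind_action G (SOME t. t \<in> C) f x = (if C = q <#\<^bsub>G\<^esub> R then c else 0)" if C: "C \<in> ?S" for C
  proof -
    note rep = coset_representative[OF Q(2) R C]
    have "(SOME t. t \<in> C) \<in> carrier G" using rep(1) subgroup.mem_carrier[OF Q(2)] by blast
    then have "inv (SOME t. t \<in> C) \<otimes> q \<in> R \<longleftrightarrow> C = q <#\<^bsub>G\<^esub> R"
      using left_cosets_eq_iff[OF R(1) _ qG] rep(2) by metis
    then show ?thesis using f[OF rep(1)] x by (simp add: ind_action_def)
  qed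
  then have "rel_trace G Q R (ind_action G) f x = (\<Sum>C\<in>?S. if C = q <#\<^bsub>G\<^esub> R then c else 0)"
    unfolding rel_trace_def by (intro sum.cong) auto
  also have "\<dots> = c" using Q(1) q by simp
  finally show ?thesis .
qed

text \<open>The left cosets of \<open>R\<close> tile \<open>Q\<close>: a point of \<open>Q\<close>
  lies in exactly one of them, a point outside in none.\<close>

lemma (in group) rel_trace_indicator:
  assumes "finite Q" "subgroup Q G" "subgroup R G" "R \<subseteq> Q"
  shows "rel_trace G Q R (ind_action G) (indicator R) = (indicator Q :: 'a \<Rightarrow> 'k::field)"
proof
  fix x
  show "rel_trace G Q R (ind_action G) (indicator R) x = (indicator Q x :: 'k)"
  proof (cases "x \<in> Q")
    case True
    then have "x \<in> carrier G" using subgroup.mem_carrier[OF assms(2)] by blast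
    then have "rel_trace G Q R (ind_action G) (indicator R) x = (1 :: 'k)"
      by (rule rel_trace_apply_single_coset[OF assms _ True]) (simp add: indicator_def)
    then show ?thesis using True by simp
  next
    case False
    have "ind_action G (SOME t. t \<in> C) (indicator R) x = (0 :: 'k)"
      if C: "C \<in> (\<lambda>t. t <#\<^bsub>G\<^esub> R) ` Q" for C
    proof -
      define t where "t = (SOME t. t \<in> C)"
      have t: "t \<in> Q" "t \<in> carrier G"
        using coset_representative(1)[OF assms(2-4) C] subgroup.mem_carrier[OF assms(2)]
        by (auto simp: t_def)
      have "inv t \<otimes> x \<notin> R" if "x \<in> carrier G"
      proof
        assume "inv t \<otimes> x \<in> R"
        then have "t \<otimes> (inv t \<otimes> x) \<in> Q" using t assms(4) subgroup.m_closed[OF assms(2)] by blast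
        then show False using False t that by (simp add: m_assoc[symmetric])
      qed
      then show ?thesis by (simp add: t_def ind_action_def)
    qed
    then show ?thesis using False by (simp add: rel_trace_def)
  qed
qed

section \<open>Indices in p-groups, trivial actions and the Brauer kernel\<close>

lemma (in group) p_dvd_index_of_proper_subgroup:
  assumes "prime p" "finite (carrier G)" "p_subgroup G p Q" "subgroup R G" "R \<subset> Q"
  shows "p dvd card ((\<lambda>t. t <#\<^bsub>G\<^esub> R) ` Q)"
proof -
  have Q: "subgroup Q G" "finite Q" using assms by (auto simp: p_subgroup_def p_group_set_def)
  obtain n where n: "card Q = p ^ n" using assms by (auto simp: p_subgroup_def p_group_set_def)
  have eq: "card ((\<lambda>t. t <#\<^bsub>G\<^esub> R) ` Q) * card R = card Q"
    using card_left_cosets[OF assms(2) Q(1) assms(4)] assms(5) by blast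
  then have "card ((\<lambda>t. t <#\<^bsub>G\<^esub> R) ` Q) dvd p ^ n" using n by (metis dvd_triv_left)
  then obtain i where i: "card ((\<lambda>t. t <#\<^bsub>G\<^esub> R) ` Q) = p ^ i"
    using assms(1) by (auto simp: divides_primepow_nat)
  moreover have "i \<noteq> 0"
    using psubset_card_mono[OF Q(2) assms(5)] eq i by (intro notI) simp
  ultimately show ?thesis by simp
qed

text \<open>Where \<open>Q\<close> acts trivially, a trace from \<open>R\<close> is multiplication
  by the index of \<open>R\<close> in \<open>Q\<close>, which is divisible by \<open>p\<close> for
  proper \<open>R\<close> and so vanishes in the field. Thus the Brauer construction at
  \<open>Q\<close> is \<open>V\<close> itself.\<close>

lemma (in group) brauer_kernel_trivial_action:
  fixes V :: "('x \<Rightarrow> 'k::field) set"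
  assumes p: "prime p" "CHAR('k) = p" and fin: "finite (carrier G)" and Q: "p_subgroup G p Q"
    and zero: "(\<lambda>_. 0) \<in> V" and triv: "\<And>q v. q \<in> Q \<Longrightarrow> v \<in> V \<Longrightarrow> \<rho> q v = v"
  shows "brauer_kernel G Q \<rho> V = {\<lambda>_. 0}"
proof -
  have tr0: "rel_trace G Q R \<rho> v = (\<lambda>_. 0)"
    if R: "subgroup R G" "R \<subset> Q" and v: "v \<in> fixed_pts R \<rho> V" for R v
  proof -
    have "(of_nat (card ((\<lambda>t. t <#\<^bsub>G\<^esub> R) ` Q)) :: 'k) = 0"
      using p_dvd_index_of_proper_subgroup[OF p(1) fin Q R] p(2)
      by (simp add: of_nat_eq_0_iff_char_dvd)
    moreover have "rel_trace G Q R \<rho> v = (\<lambda>x. of_nat (card ((\<lambda>t. t <#\<^bsub>G\<^esub> R) ` Q)) * v x)"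
      by (rule rel_trace_of_fixed) (use R Q v triv in \<open>auto simp: p_subgroup_def fixed_pts_def\<close>)
    ultimately show ?thesis by simp
  qed
  have "(\<lambda>_. 0) \<in> fixed_pts R \<rho> V" if "R \<subset> Q" for R
    using that zero triv by (auto simp: fixed_pts_def)
  then have img: "rel_trace G Q R \<rho> ` fixed_pts R \<rho> V = {\<lambda>_. 0}"
    if "R \<in> {R. subgroup R G \<and> R \<subset> Q}" for R
    using that tr0[of R] by (auto simp: image_iff)
  show ?thesis
  proof
    show "brauer_kernel G Q \<rho> V \<subseteq> {\<lambda>_. 0}"
      using img by (auto simp: brauer_kernel_def)
    show "{\<lambda>_. 0} \<subseteq> brauer_kernel G Q \<rho> V"
      using img by (auto simp: brauer_kernel_def intro!: exI[where x = "\<lambda>_ _. 0"])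
  qed
qed

lemma rel_trace_mem_brauer_kernel:
  assumes "finite Q" "subgroup R G" "R \<subset> Q" "(\<lambda>_. 0) \<in> V" "v \<in> fixed_pts R (ind_action G) V"
  shows "rel_trace G Q R (ind_action G) v \<in> brauer_kernel G Q (ind_action G) V"
proof -
  let ?S = "{R. subgroup R G \<and> R \<subset> Q}"
  let ?tr = "rel_trace G Q R (ind_action G) v"
  \<comment> \<open>\<open>brauer_kernel\<close> asks for one trace from every proper subgroup; the
    trace of zero fills all slots other than \<open>R\<close>.\<close>
  define f where "f T = (if T = R then ?tr else (\<lambda>_. 0))" for T
  have "?S \<subseteq> Pow Q" by auto
  then have finS: "finite ?S" using assms(1) by (metis finite_Pow_iff finite_subset)
  have "(\<Sum>T\<in>?S. f T x) = (\<Sum>T\<in>?S. if T = R then ?tr x else 0)" for x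
    by (intro sum.cong) (auto simp: f_def)
  then have "?tr = (\<lambda>x. \<Sum>T\<in>?S. f T x)"
    using finS assms(2,3) by simp
  moreover have "f T \<in> rel_trace G Q T (ind_action G) ` fixed_pts T (ind_action G) V" if "T \<in> ?S" for T
  proof (cases "T = R")
    case True
    then show ?thesis using assms(5) by (simp add: f_def)
  next
    case False
    have "(\<lambda>_. 0) \<in> fixed_pts T (ind_action G) V" using assms(4) by (simp add: fixed_pts_def)
    then have "rel_trace G Q T (ind_action G) (\<lambda>_. 0) \<in>
        rel_trace G Q T (ind_action G) ` fixed_pts T (ind_action G) V"
      by (rule imageI)
    then show ?thesis using False by (simp add: f_def)
  qed
  ultimately show ?thesis unfolding brauer_kernel_def by blast
qed

text \<open>Normality of \<open>K\<close> makes \<open>Q \<inter> K\<close> the stabilizer in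
  \<open>Q\<close> of every point of \<open>G / K\<close>. A \<open>Q\<close>-fixed function is
  therefore the trace, from this proper subgroup, of its restriction to one point per orbit.\<close>

lemma (in group) fixed_pts_subset_brauer_kernel:
  assumes fin: "finite (carrier G)" and K: "K \<lhd> G" and Q: "subgroup Q G" "\<not> Q \<subseteq> K"
  shows "fixed_pts Q (ind_action G) (ind_space G K) \<subseteq> brauer_kernel G Q (ind_action G) (ind_space G K)"
proof
  interpret K: normal K G by (rule K)
  fix f assume "f \<in> fixed_pts Q (ind_action G) (ind_space G K)"
  then have f: "f \<in> ind_space G K" and fQ: "\<And>q. q \<in> Q \<Longrightarrow> ind_action G q f = f"
    by (auto simp: fixed_pts_def)
  have QG: "\<And>q. q \<in> Q \<Longrightarrow> q \<in> carrier G" using subgroup.mem_carrier[OF Q(1)] .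
  have finQ: "finite Q" using finite_subset[OF subgroup.subset[OF Q(1)] fin] .
  define R where "R = Q \<inter> K"
  have R: "subgroup R G" "R \<subset> Q"
    using Q K.subgroup_axioms by (auto simp: R_def subgroups_Inter_pair)
  \<comment> \<open>The double coset \<open>Q x K\<close>, that is, the \<open>Q\<close>-orbit of
    the point \<open>x K\<close>.\<close>
  define D where "D x = {q \<otimes> x \<otimes> k | q k. q \<in> Q \<and> k \<in> K}" for x
  have D_eq: "D (q \<otimes> x \<otimes> k) = D x" if x: "x \<in> carrier G" and q: "q \<in> Q" and k: "k \<in> K" for q x k
  proof
    show "D (q \<otimes> x \<otimes> k) \<subseteq> D x"
    proof
      fix y assume "y \<in> D (q \<otimes> x \<otimes> k)"
      then obtain a b where ab: "a \<in> Q" "b \<in> K" "y = a \<otimes> (q \<otimes> x \<otimes> k) \<otimes> b" by (auto simp: D_def)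
      then have "y = (a \<otimes> q) \<otimes> x \<otimes> (k \<otimes> b)" using x q k QG by (simp add: m_assoc)
      then show "y \<in> D x"
        using ab q k subgroup.m_closed[OF Q(1)] K.m_closed unfolding D_def by blast
    qed
    show "D x \<subseteq> D (q \<otimes> x \<otimes> k)"
    proof
      fix y assume "y \<in> D x"
      then obtain a b where ab: "a \<in> Q" "b \<in> K" "y = a \<otimes> x \<otimes> b" by (auto simp: D_def)
      have "inv q \<otimes> (q \<otimes> z) = z" if "z \<in> carrier G" for z
        using that q QG by (simp add: m_assoc[symmetric])
      moreover have "k \<otimes> (inv k \<otimes> z) = z" if "z \<in> carrier G" for z
        using that k by (simp add: m_assoc[symmetric])
      ultimately have "y = (a \<otimes> inv q) \<otimes> (q \<otimes> x \<otimes> k) \<otimes> (inv k \<otimes> b)"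
        using ab x q k QG by (simp add: m_assoc)
      then show "y \<in> D (q \<otimes> x \<otimes> k)"
        using ab q k subgroupE(3,4)[OF Q(1)] K.m_closed K.m_inv_closed unfolding D_def by blast
    qed
  qed
  \<comment> \<open>The choice depends on \<open>D x\<close> only, so all elements of a double coset
    share one representative.\<close>
  define r where "r x = (SOME y. y \<in> D x)" for x
  have r_mem: "r x \<in> D x" if "x \<in> carrier G" for x
  proof -
    have "\<one> \<otimes> x \<otimes> \<one> \<in> D x" using subgroup.one_closed[OF Q(1)] K.one_closed unfolding D_def by blast
    then show ?thesis unfolding r_def by (rule someI)
  qed
  \<comment> \<open>This is \<open>f\<close> cut down to the single coset of \<open>K\<close>
    through \<open>r x\<close> in each double coset.\<close>
  define f' where "f' x = (if x \<in> carrier G \<and> inv (r x) \<otimes> x \<in> K then f x else 0)" for x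
  have rG: "r x \<in> carrier G" if "x \<in> carrier G" for x
    using r_mem[OF that] that QG by (auto simp: D_def)
  have f': "f' \<in> ind_space G K"
  proof (rule ind_spaceI)
    fix x k assume x: "x \<in> carrier G" and k: "k \<in> K"
    have kG: "k \<in> carrier G" using k by simp
    have "D (x \<otimes> k) = D x" using D_eq[OF x subgroup.one_closed[OF Q(1)] k] x by simp
    then have "r (x \<otimes> k) = r x" by (simp add: r_def)
    moreover have "inv (r x) \<otimes> (x \<otimes> k) \<in> K \<longleftrightarrow> inv (r x) \<otimes> x \<in> K"
    proof
      assume "inv (r x) \<otimes> (x \<otimes> k) \<in> K"
      then have "(inv (r x) \<otimes> (x \<otimes> k)) \<otimes> inv k \<in> K" using k K.m_closed K.m_inv_closed by blast
      then show "inv (r x) \<otimes> x \<in> K" using x kG rG[OF x] by (simp add: m_assoc)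
    next
      assume "inv (r x) \<otimes> x \<in> K"
      then have "(inv (r x) \<otimes> x) \<otimes> k \<in> K" using k by simp
      then show "inv (r x) \<otimes> (x \<otimes> k) \<in> K" using x kG rG[OF x] by (simp add: m_assoc)
    qed
    ultimately show "f' (x \<otimes> k) = f' x"
      using x kG ind_space_right_invariant[OF f x k] by (simp add: f'_def)
  qed (simp add: f'_def)
  have "f = rel_trace G Q R (ind_action G) f'"
  proof
    fix x
    show "f x = rel_trace G Q R (ind_action G) f' x"
    proof (cases "x \<in> carrier G")
      case False
      then show ?thesis using ind_space_outside[OF f] by (simp add: rel_trace_def ind_action_def)
    next
      case x: True
      obtain a b where ab: "a \<in> Q" "b \<in> K" "r x = a \<otimes> x \<otimes> b" using r_mem[OF x] by (auto simp: D_def)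
      have abG: "a \<in> carrier G" "b \<in> carrier G" using ab QG by auto
      \<comment> \<open>From \<open>r x = a \<otimes> x \<otimes> b\<close>, the point
        \<open>inv t \<otimes> x\<close> lies in the coset of \<open>K\<close> through
        \<open>r x\<close> exactly when \<open>t\<close> lies in the coset of \<open>R\<close>
        through \<open>inv a\<close>; hence the choice of \<open>q\<close>.\<close>
      have "rel_trace G Q R (ind_action G) f' x = f x"
      proof (rule rel_trace_apply_single_coset[OF finQ Q(1) R(1) _ x, where q = "inv a"])
        show "R \<subseteq> Q" using R by blast
        show "inv a \<in> Q" using ab subgroupE(3)[OF Q(1)] by blast
        fix t assume t: "t \<in> Q"
        have tG: "t \<in> carrier G" using t QG by blast
        have "D (inv t \<otimes> x) = D x"
          using D_eq[OF x subgroup.m_inv_closed[OF Q(1) t] K.one_closed] x tG by simp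
        then have rt: "r (inv t \<otimes> x) = r x" by (simp add: r_def)
        \<comment> \<open>A conjugate of \<open>inv a \<otimes> inv t\<close> by \<open>x\<close>;
          by normality its membership in \<open>K\<close> does not depend on
          \<open>x\<close>.\<close>
        define z where "z = inv x \<otimes> (inv a \<otimes> inv t) \<otimes> x"
        have "inv (r x) \<otimes> (inv t \<otimes> x) = inv b \<otimes> z"
          using ab abG x tG by (simp add: z_def inv_mult_group m_assoc)
        moreover have "inv b \<otimes> z \<in> K \<longleftrightarrow> z \<in> K"
        proof
          assume "inv b \<otimes> z \<in> K"
          then have "b \<otimes> (inv b \<otimes> z) \<in> K" using ab by simp
          then show "z \<in> K" using abG x tG by (simp add: z_def m_assoc[symmetric])
        qed (use ab in simp)
        moreover have "z \<in> K \<longleftrightarrow> inv a \<otimes> inv t \<in> K"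
        proof
          assume "z \<in> K"
          then have "x \<otimes> z \<otimes> inv x \<in> K" using x K.inv_op_closed2 by blast
          moreover have "x \<otimes> z \<otimes> inv x = (x \<otimes> inv x) \<otimes> (inv a \<otimes> inv t) \<otimes> (x \<otimes> inv x)"
            using abG x tG unfolding z_def by (simp only: m_assoc m_closed inv_closed)
          ultimately show "inv a \<otimes> inv t \<in> K" using abG x tG by simp
        qed (use x K.inv_op_closed1 in \<open>simp add: z_def\<close>)
        moreover have "inv a \<otimes> inv t \<in> K \<longleftrightarrow> inv t \<otimes> inv a \<in> R"
        proof -
          \<comment> \<open>The products in the two orders are conjugate under \<open>t\<close>, so
            normality of \<open>K\<close> exchanges them.\<close>
          have conj: "inv t \<otimes> inv a = inv t \<otimes> (inv a \<otimes> inv t) \<otimes> inv (inv t)"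
            "inv a \<otimes> inv t = t \<otimes> (inv t \<otimes> inv a) \<otimes> inv t"
            using abG tG by (simp_all add: m_assoc[symmetric]) (simp add: m_assoc)
          have "inv t \<otimes> inv a \<in> Q" using ab t subgroupE(3,4)[OF Q(1)] by blast
          moreover have "inv t \<otimes> inv a \<in> K" if "inv a \<otimes> inv t \<in> K"
            by (subst conj(1)) (rule K.inv_op_closed2[OF inv_closed[OF tG] that])
          moreover have "inv a \<otimes> inv t \<in> K" if "inv t \<otimes> inv a \<in> K"
            by (subst conj(2)) (rule K.inv_op_closed2[OF tG that])
          ultimately show ?thesis unfolding R_def by blast
        qed
        moreover have "f (inv t \<otimes> x) = f x" using fun_cong[OF fQ[OF t], of x] x by (simp add: ind_action_def)
        ultimately show "f' (inv t \<otimes> x) = (if inv t \<otimes> inv a \<in> R then f x else 0)"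
          using x tG rt by (simp add: f'_def)
      qed
      then show ?thesis by simp
    qed
  qed
  moreover have "f' \<in> fixed_pts R (ind_action G) (ind_space G K)"
    using f' K.ind_action_trivial[OF f'] by (auto simp: fixed_pts_def R_def)
  ultimately show "f \<in> brauer_kernel G Q (ind_action G) (ind_space G K)"
    using rel_trace_mem_brauer_kernel[OF finQ R fsubspace_zero[OF fsubspace_ind_space]] by metis
qed

section \<open>Scott modules\<close>

lemma (in group) subgroup_centralizer:
  assumes "Q \<subseteq> carrier G"
  shows "subgroup (centralizer G Q) G"
proof (rule subgroupI)
  show "centralizer G Q \<subseteq> carrier G" by (auto simp: centralizer_def)
  show "centralizer G Q \<noteq> {}" using assms by (auto simp: centralizer_def subset_iff intro!: exI[of _ \<one>])
  show "inv a \<in> centralizer G Q" if a: "a \<in> centralizer G Q" for a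
  proof -
    have aG: "a \<in> carrier G" and comm: "\<And>q. q \<in> Q \<Longrightarrow> a \<otimes> q = q \<otimes> a"
      using a by (auto simp: centralizer_def)
    have "inv a \<otimes> q = q \<otimes> inv a" if "q \<in> Q" for q
    proof -
      have qG: "q \<in> carrier G" using that assms by blast
      have "inv a \<otimes> q = inv a \<otimes> (q \<otimes> a) \<otimes> inv a" using aG qG by (simp add: m_assoc)
      also have "\<dots> = inv a \<otimes> (a \<otimes> q) \<otimes> inv a" using comm[OF that] by simp
      also have "\<dots> = q \<otimes> inv a" using aG qG by (simp add: m_assoc[symmetric])
      finally show ?thesis .
    qed
    then show ?thesis using aG by (simp add: centralizer_def)
  qed
  show "a \<otimes> b \<in> centralizer G Q" if a: "a \<in> centralizer G Q" and b: "b \<in> centralizer G Q" for a b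
  proof -
    have G: "a \<in> carrier G" "b \<in> carrier G"
      and comm: "\<And>q. q \<in> Q \<Longrightarrow> a \<otimes> q = q \<otimes> a" "\<And>q. q \<in> Q \<Longrightarrow> b \<otimes> q = q \<otimes> b"
      using a b by (auto simp: centralizer_def)
    have "a \<otimes> b \<otimes> q = q \<otimes> (a \<otimes> b)" if "q \<in> Q" for q
    proof -
      have qG: "q \<in> carrier G" using that assms by blast
      have "a \<otimes> b \<otimes> q = a \<otimes> q \<otimes> b" using comm(2)[OF that] G qG by (simp add: m_assoc)
      then show ?thesis using comm(1)[OF that] G qG by (simp add: m_assoc)
    qed
    then show ?thesis using G by (simp add: centralizer_def)
  qed
qed

lemma ssumI: "c \<in> C \<Longrightarrow> d \<in> D \<Longrightarrow> f = (\<lambda>x. c x + d x) \<Longrightarrow> f \<in> ssum C D"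
  unfolding ssum_def by blast

lemma (in group) indicator_carrier_nonzero: "(indicator (carrier G) :: 'a \<Rightarrow> 'k::field) \<noteq> (\<lambda>_. 0)"
  by (auto simp: fun_eq_iff intro!: exI[of _ \<one>])

lemma (in group) ind_action_indicator_carrier:
  "g \<in> carrier G \<Longrightarrow> ind_action G g (indicator (carrier G)) = indicator (carrier G)"
  by (auto simp: ind_action_def fun_eq_iff)

lemma (in group) subgroup_mult_right_mem_iff:
  assumes "subgroup K G" "x \<in> carrier G" "h \<in> K"
  shows "x \<otimes> h \<in> K \<longleftrightarrow> x \<in> K"
proof
  assume "x \<otimes> h \<in> K"
  then have "x \<otimes> h \<otimes> inv h \<in> K" using assms(3) subgroupE(3,4)[OF assms(1)] by blast
  then show "x \<in> K" using assms subgroup.mem_carrier[OF assms(1)] by (simp add: m_assoc)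
qed (use assms(3) subgroup.m_closed[OF assms(1)] in blast)

lemma (in group) indicator_mem_ind_space:
  assumes "subgroup K G" "subgroup H G" "H \<subseteq> K"
  shows "indicator K \<in> ind_space G H"
proof (rule ind_spaceI)
  fix x h assume x: "x \<in> carrier G" and h: "h \<in> H"
  have hG: "h \<in> carrier G" "h \<in> K" using h assms subgroup.mem_carrier[OF assms(2)] by auto
  have "x \<otimes> h \<in> K \<longleftrightarrow> x \<in> K" by (rule subgroup_mult_right_mem_iff[OF assms(1) x hG(2)])
  then show "indicator K (x \<otimes> h) = indicator K x" by (simp add: indicator_def)
qed (use subgroup.mem_carrier[OF assms(1)] in \<open>auto simp: indicator_def\<close>)

text \<open>Two nonzero summands would both contain the constants, so the whole permutation module
  is indecomposable and is its own Scott module, with complement zero. This lets the hypothesis on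
  the normalizer be applied to \<open>ind_space\<close>.\<close>

lemma (in group) scott_module_of_p_group:
  assumes p: "prime p" "CHAR('k::field) = p" "p_group_set p (carrier G)" and P: "subgroup P G"
  shows "scott_module G P (ind_space G P :: ('a \<Rightarrow> 'k) set)"
proof -
  let ?V = "ind_space G P :: ('a \<Rightarrow> 'k) set"
  let ?one = "indicator (carrier G) :: 'a \<Rightarrow> 'k"
  have G: "p_subgroup G p (carrier G)" using p subgroup_self by (simp add: p_subgroup_def)
  have cover: "\<exists>n\<in>carrier G. \<exists>h\<in>P. g = n \<otimes> h" if "g \<in> carrier G" for g
    using that subgroup.one_closed[OF P] r_one by metis
  have one: "?one \<in> ?V"
    using indicator_mem_ind_space[OF subgroup_self P subgroup.subset[OF P]] .
  have one0: "?one \<noteq> (\<lambda>_. 0)" by (rule indicator_carrier_nonzero)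
  have zero: "stable_sub (carrier G) (ind_action G) ?V {\<lambda>_. 0}"
    using fsubspace_zero[OF fsubspace_ind_space[of G P]] by (auto simp: stable_sub_def fsubspace_def)
  have "ssum ?V {\<lambda>_. 0} = ?V" by (auto simp: ssum_def)
  moreover have "?V \<inter> {\<lambda>_. 0} = {\<lambda>_. 0}" using zero by (auto simp: stable_sub_def)
  moreover have "indecomposable (carrier G) (ind_action G) ?V"
    unfolding indecomposable_def
  proof (intro conjI notI)
    assume "?V = {\<lambda>_. 0}"
    then show False using one one0 by blast
  next
    assume "\<exists>C D. stable_sub (carrier G) (ind_action G) ?V C \<and> stable_sub (carrier G) (ind_action G) ?V D
      \<and> C \<noteq> {\<lambda>_. 0} \<and> D \<noteq> {\<lambda>_. 0} \<and> ssum C D = ?V \<and> C \<inter> D = {\<lambda>_. 0}"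
    then obtain C D where CD: "stable_sub (carrier G) (ind_action G) ?V C" "C \<noteq> {\<lambda>_. 0}"
        "stable_sub (carrier G) (ind_action G) ?V D" "D \<noteq> {\<lambda>_. 0}" "C \<inter> D = {\<lambda>_. 0}"
      by blast
    have "?one \<in> C" "?one \<in> D"
      by (rule indicator_mem_stable_sub[OF p(1,2) G]; use CD cover in blast)+
    then show False using CD(5) one0 by blast
  qed
  ultimately show ?thesis
    unfolding scott_module_def
    using stable_ind_space[OF P] zero one one0 ind_action_indicator_carrier by blast
qed

text \<open>As \<open>Q\<close> acts trivially, the module is its own Brauer construction at
  \<open>Q\<close>. If \<open>H\<close>, the product of \<open>P\<close> and the centralizer, were
  proper, the functions supported on \<open>H\<close> and those supported off it would decompose the
  module.\<close>

lemma (in group) centralizer_cover_of_brauer_indecomposable: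
  assumes p: "prime p" "CHAR('k::field) = p" and fin: "finite (carrier G)" and P: "P \<lhd> G"
    and B: "brauer_indecomposable G p (ind_action G) (ind_space G P :: ('a \<Rightarrow> 'k) set)"
    and Q: "p_subgroup G p Q" "Q \<subseteq> P"
  shows "P <#> centralizer G Q = carrier G"
proof (rule ccontr)
  interpret P: normal P G by (rule P)
  let ?V = "ind_space G P :: ('a \<Rightarrow> 'k) set"
  define H where "H = P <#> centralizer G Q"
  have QG: "subgroup Q G" "Q \<subseteq> carrier G" using Q subgroup.subset by (auto simp: p_subgroup_def)
  note Cs = subgroup_centralizer[OF QG(2)]
  have H: "subgroup H G" unfolding H_def by (rule mult_norm_subgroup[OF P Cs])
  have PH: "P \<subseteq> H"
    unfolding H_def set_mult_def using subgroup.one_closed[OF Cs] P.mem_carrier by force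
  have QCH: "Q <#> centralizer G Q \<subseteq> H"
    unfolding H_def set_mult_def using Q(2) by blast
  assume "P <#> centralizer G Q \<noteq> carrier G"
  then obtain y where y: "y \<in> carrier G" "y \<notin> H"
    using subgroup.subset[OF H] by (auto simp: H_def)
  \<comment> \<open>Both \<open>H\<close> and its complement are unions of left cosets of
    \<open>P\<close>, so cutting a function off along \<open>H\<close> stays in
    \<open>?V\<close>.\<close>
  have H_right: "x \<otimes> h \<in> H \<longleftrightarrow> x \<in> H" if "x \<in> carrier G" "h \<in> P" for x h
    using subgroup_mult_right_mem_iff[OF H] that PH by blast
  \<comment> \<open>Left translation by \<open>H\<close> preserves \<open>H\<close> and its
    complement, which makes \<open>C\<close> and \<open>D\<close> below stable.\<close>
  have H_left: "inv h \<otimes> x \<in> H \<longleftrightarrow> x \<in> H" if "x \<in> carrier G" "h \<in> H" for x h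
  proof
    have hG: "h \<in> carrier G" using that subgroup.mem_carrier[OF H] by blast
    assume "inv h \<otimes> x \<in> H"
    then have "h \<otimes> (inv h \<otimes> x) \<in> H" using that subgroup.m_closed[OF H] by blast
    then show "x \<in> H" using that hG by (simp add: m_assoc[symmetric])
  qed (use that subgroupE(3,4)[OF H] in blast)
  define C where "C = {f \<in> ?V. \<forall>x. x \<notin> H \<longrightarrow> f x = 0}"
  define D where "D = {f \<in> ?V. \<forall>x\<in>H. f x = 0}"
  have fix_V: "fixed_pts Q (ind_action G) ?V = ?V"
    using P.ind_action_trivial Q(2) by (auto simp: fixed_pts_def)
  have ker: "brauer_kernel G Q (ind_action G) ?V = {\<lambda>_. 0}"
    by (rule brauer_kernel_trivial_action[OF p fin Q(1) fsubspace_zero[OF fsubspace_ind_space]])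
      (use P.ind_action_trivial Q(2) in blast)
  have V: "fsubspace ?V" by (rule fsubspace_ind_space)
  then have sub: "fsubspace C" "fsubspace D" by (auto simp: C_def D_def fsubspace_def)
  have act_V: "ind_action G g f \<in> ?V" if "g \<in> H" "f \<in> ?V" for g f
    using that stable_ind_space[OF P.subgroup_axioms] subgroup.mem_carrier[OF H]
    by (auto simp: stable_sub_def)
  have "stable_sub (Q <#> centralizer G Q) (ind_action G) ?V C"
    "stable_sub (Q <#> centralizer G Q) (ind_action G) ?V D"
    using sub QCH act_V H_left subgroup.mem_carrier[OF H]
    by (auto simp: stable_sub_def C_def D_def ind_action_def)
  moreover have "{\<lambda>_. 0} \<subseteq> C" "{\<lambda>_. 0} \<subseteq> D" using sub fsubspace_zero by auto
  moreover have "C \<noteq> {\<lambda>_. 0}"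
  proof -
    have "indicator H \<in> C"
      using indicator_mem_ind_space[OF H P.subgroup_axioms PH] by (auto simp: C_def)
    moreover have "indicator H \<one> \<noteq> (0 :: 'k)" using subgroup.one_closed[OF H] by simp
    ultimately show ?thesis by auto
  qed
  moreover have "D \<noteq> {\<lambda>_. 0}"
  proof -
    have "indicator (carrier G - H) \<in> ?V"
      by (rule ind_spaceI) (use H_right P.mem_carrier in \<open>auto simp: indicator_def\<close>)
    then have "indicator (carrier G - H) \<in> D" by (auto simp: D_def)
    moreover have "indicator (carrier G - H) y \<noteq> (0 :: 'k)" using y by simp
    ultimately show ?thesis by auto
  qed
  moreover have "ssum C D = ?V"
  proof
    show "ssum C D \<subseteq> ?V"
      using fsubspace_add[OF V] by (auto simp: ssum_def C_def D_def)
    show "?V \<subseteq> ssum C D"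
    proof
      fix f assume f: "f \<in> ?V"
      have "(\<lambda>x. if x \<in> H then f x else 0) \<in> C" "(\<lambda>x. if x \<in> H then 0 else f x) \<in> D"
        using f H_right by (auto simp: C_def D_def ind_space_def)
      moreover have "f = (\<lambda>x. (if x \<in> H then f x else 0) + (if x \<in> H then 0 else f x))" by auto
      ultimately show "f \<in> ssum C D" by (rule ssumI)
    qed
  qed
  moreover have "C \<inter> D = {\<lambda>_. 0}"
  proof
    show "C \<inter> D \<subseteq> {\<lambda>_. 0}" unfolding C_def D_def by (auto simp: fun_eq_iff)
    show "{\<lambda>_. 0} \<subseteq> C \<inter> D" using sub fsubspace_zero by auto
  qed
  moreover have "subquot_indec_or_zero (Q <#> centralizer G Q) (ind_action G) ?V {\<lambda>_. 0}"
  proof -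
    have "subquot_indec_or_zero (Q <#> centralizer G Q) (ind_action G)
        (fixed_pts Q (ind_action G) ?V) (brauer_kernel G Q (ind_action G) ?V)"
      using B Q(1) unfolding brauer_indecomposable_def by blast
    then show ?thesis by (simp only: fix_V ker)
  qed
  ultimately show False unfolding subquot_indec_or_zero_def by blast
qed

section \<open>The kernel of the Scott module\<close>

lemma (in group) module_kernel_normal:
  assumes M: "stable_sub (carrier G) (ind_action G) (ind_space G P) M"
  shows "module_kernel G (ind_action G) M \<lhd> G"
proof -
  let ?K = "module_kernel G (ind_action G) M"
  have stab: "\<And>g v. g \<in> carrier G \<Longrightarrow> v \<in> M \<Longrightarrow> ind_action G g v \<in> M"
    and one: "\<And>v. v \<in> M \<Longrightarrow> ind_action G \<one> v = v"
    using M ind_action_one by (auto simp: stable_sub_def)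
  have cancel: "ind_action G g (ind_action G (inv g) v) = v" if "g \<in> carrier G" "v \<in> M" for g v
    using ind_action_mult[of g "inv g" v] that one by simp
  have K: "subgroup ?K G"
  proof (rule subgroupI)
    show "inv a \<in> ?K" if "a \<in> ?K" for a
    proof -
      have a: "a \<in> carrier G" "\<And>v. v \<in> M \<Longrightarrow> ind_action G a v = v"
        using that by (auto simp: module_kernel_def)
      then have "ind_action G (inv a) v = v" if "v \<in> M" for v
        using cancel[OF a(1) that] stab[of "inv a" v] that by simp
      then show ?thesis using a by (simp add: module_kernel_def)
    qed
    show "a \<otimes> b \<in> ?K" if "a \<in> ?K" "b \<in> ?K" for a b
      using that by (auto simp: module_kernel_def ind_action_mult)
  qed (use one in \<open>auto simp: module_kernel_def\<close>)
  moreover have "g \<otimes> k \<otimes> inv g \<in> ?K" if g: "g \<in> carrier G" and k: "k \<in> ?K" for g k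
  proof -
    have kG: "k \<in> carrier G" "\<And>v. v \<in> M \<Longrightarrow> ind_action G k v = v"
      using k by (auto simp: module_kernel_def)
    have "ind_action G (g \<otimes> k \<otimes> inv g) v = v" if "v \<in> M" for v
      using g kG that stab[of "inv g" v] cancel[OF g that] by (simp add: ind_action_mult)
    then show ?thesis using g kG by (simp add: module_kernel_def)
  qed
  ultimately show ?thesis by (simp add: normal_inv_iff)
qed

lemma (in group) scott_module_indicator_mem:
  fixes M :: "('a \<Rightarrow> 'k::field) set"
  assumes "stable_sub (carrier G) (ind_action G) (ind_space G P) M" and P: "subgroup P G"
    and v: "v \<in> M" "v \<noteq> (\<lambda>_. 0)" "\<forall>g\<in>carrier G. ind_action G g v = v"
  shows "indicator (carrier G) \<in> M"
proof -
  have M: "fsubspace M" "M \<subseteq> ind_space G P" using assms(1) by (auto simp: stable_sub_def)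
  have cover: "\<exists>n\<in>carrier G. \<exists>h\<in>P. g = n \<otimes> h" if "g \<in> carrier G" for g
    using that subgroup.one_closed[OF P] r_one by metis
  show ?thesis by (rule indicator_mem_of_fixed[OF M v(1,2) order_refl cover]) (use v(3) in auto)
qed

lemma (in group) index_in_module_kernel_not_dvd:
  fixes M W :: "('a \<Rightarrow> 'k::field) set"
  assumes p: "CHAR('k) = p" and fin: "finite (carrier G)" and P: "subgroup P G"
    and M: "stable_sub (carrier G) (ind_action G) (ind_space G P) M"
    and W: "stable_sub (carrier G) (ind_action G) (ind_space G P) W"
    and MW: "ssum M W = ind_space G P" "M \<inter> W = {\<lambda>_. 0}"
    and one: "indicator (carrier G) \<in> M"
    and PK: "P \<subseteq> module_kernel G (ind_action G) M"
  shows "\<not> p dvd card ((\<lambda>t. t <#\<^bsub>G\<^esub> P) ` module_kernel G (ind_action G) M)"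
proof
  define K where "K = module_kernel G (ind_action G) M"
  assume "p dvd card ((\<lambda>t. t <#\<^bsub>G\<^esub> P) ` module_kernel G (ind_action G) M)"
  then have index: "(of_nat (card ((\<lambda>t. t <#\<^bsub>G\<^esub> P) ` K)) :: 'k) = 0"
    using p by (simp add: of_nat_eq_0_iff_char_dvd K_def)
  have K: "subgroup K G" unfolding K_def by (rule normal_imp_subgroup[OF module_kernel_normal[OF M]])
  have PK': "P \<subseteq> K" using PK K_def by simp
  have KG: "K \<subseteq> carrier G" using K subgroup.subset by blast
  have finK: "finite K" using KG fin finite_subset by blast
  have "(indicator P :: 'a \<Rightarrow> 'k) \<in> ind_space G P" by (rule indicator_mem_ind_space[OF P P order_refl])
  then obtain m w where mw: "m \<in> M" "w \<in> W" "(indicator P :: 'a \<Rightarrow> 'k) = (\<lambda>x. m x + w x)"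
    unfolding MW(1)[symmetric] ssum_def by blast
  \<comment> \<open>\<open>K\<close> fixes \<open>m\<close>, so its trace is the index times
    \<open>m\<close>, which is zero in the field; only the trace of \<open>w\<close>
    survives.\<close>
  have "rel_trace G K P (ind_action G) m = (\<lambda>x. of_nat (card ((\<lambda>t. t <#\<^bsub>G\<^esub> P) ` K)) * m x)"
    by (rule rel_trace_of_fixed[OF K P PK']) (use mw(1) in \<open>simp add: K_def module_kernel_def\<close>)
  then have "indicator K = rel_trace G K P (ind_action G) w"
    using rel_trace_indicator[OF finK K P PK', where 'k = 'k] index
    by (simp add: mw(3) rel_trace_ind_action_add)
  also have "\<dots> \<in> W"
    by (rule rel_trace_mem[OF K P PK' _ mw(2)]) (use W KG in \<open>auto simp: stable_sub_def\<close>)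
  \<comment> \<open>Tracing on from \<open>K\<close> to \<open>G\<close> turns
    \<open>indicator K\<close> into the constant function, which then lies in both \<open>M\<close>
    and \<open>W\<close>.\<close>
  finally have "rel_trace G (carrier G) K (ind_action G) (indicator K) \<in> W"
    by (rule rel_trace_mem[OF subgroup_self K KG W])
  then have "indicator (carrier G) \<in> W"
    using rel_trace_indicator[OF fin subgroup_self K KG, where 'k = 'k] by simp
  then show False using one MW(2) indicator_carrier_nonzero by blast
qed

text \<open>For normal \<open>K\<close>, being fixed by \<open>K\<close> on the left means being
  invariant on the right, so \<open>M\<close> lies in \<open>ind_space G K\<close>. Conversely
  \<open>W \<inter> ind_space G K\<close> is zero: otherwise it would contain the constants, which
  lie in \<open>M\<close>.\<close>

lemma (in group) scott_module_eq_ind_space_kernel: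
  fixes M W :: "('a \<Rightarrow> 'k::field) set"
  assumes p: "prime p" "CHAR('k) = p" and N: "p_subgroup G p N"
    and M: "stable_sub (carrier G) (ind_action G) (ind_space G P) M"
    and W: "stable_sub (carrier G) (ind_action G) (ind_space G P) W"
    and MW: "ssum M W = ind_space G P" "M \<inter> W = {\<lambda>_. 0}"
    and one: "indicator (carrier G) \<in> M"
    and K: "K = module_kernel G (ind_action G) M" and PK: "P \<subseteq> K"
    and cover: "\<And>g. g \<in> carrier G \<Longrightarrow> \<exists>n\<in>N. \<exists>k\<in>K. g = n \<otimes> k"
  shows "M = ind_space G K"
proof
  have normalK: "K \<lhd> G" unfolding K by (rule module_kernel_normal[OF M])
  then interpret K: normal K G .
  have NG: "N \<subseteq> carrier G" using N subgroup.subset by (auto simp: p_subgroup_def)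
  show MK: "M \<subseteq> ind_space G K"
  proof
    fix f assume f: "f \<in> M"
    show "f \<in> ind_space G K"
    proof (rule ind_spaceI)
      show "f x = 0" if "x \<notin> carrier G" for x
        using f M that by (auto simp: stable_sub_def ind_space_def)
      fix x k assume x: "x \<in> carrier G" and k: "k \<in> K"
      \<comment> \<open>Chosen with \<open>k' \<otimes> x = x \<otimes> k\<close>, so that
        translation by \<open>k'\<close> carries the value at \<open>x\<close> to
        \<open>x \<otimes> k\<close>.\<close>
      define k' where "k' = x \<otimes> k \<otimes> inv x"
      have "k' \<in> K" unfolding k'_def using x k K.inv_op_closed2 by simp
      then have "ind_action G k' f = f" using f unfolding K module_kernel_def by blast
      then have "f (x \<otimes> k) = ind_action G k' f (x \<otimes> k)" by simp
      also have "\<dots> = f (inv k' \<otimes> (x \<otimes> k))" using x k by (simp add: ind_action_def)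
      also have "inv k' \<otimes> (x \<otimes> k) = x"
      proof -
        have "x \<otimes> k = k' \<otimes> x" using x k by (simp add: k'_def m_assoc)
        then show ?thesis using x \<open>k' \<in> K\<close> by (simp add: m_assoc[symmetric])
      qed
      finally show "f (x \<otimes> k) = f x" .
    qed
  qed
  show "ind_space G K \<subseteq> M"
  proof
    fix f :: "'a \<Rightarrow> 'k" assume f: "f \<in> ind_space G K"
    have "f \<in> ind_space G P" using f PK by (auto simp: ind_space_def)
    then obtain m w where mw: "m \<in> M" "w \<in> W" "f = (\<lambda>x. m x + w x)"
      unfolding MW(1)[symmetric] ssum_def by blast
    \<comment> \<open>Both \<open>f\<close> and \<open>m\<close> lie in
      \<open>ind_space G K\<close>, hence so does the component \<open>w\<close>.\<close>
    have "(\<lambda>x. f x - m x) \<in> ind_space G K"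
      using fsubspace_diff[OF fsubspace_ind_space f] mw MK by blast
    then have w: "w \<in> W \<inter> ind_space G K" using mw by simp
    have "stable_sub N (ind_action G) (ind_space G K) (W \<inter> ind_space G K)"
      unfolding stable_sub_def
    proof (intro conjI ballI)
      show "fsubspace (W \<inter> ind_space G K)"
        using W fsubspace_Int[OF _ fsubspace_ind_space] by (auto simp: stable_sub_def)
      show "ind_action G n v \<in> W \<inter> ind_space G K" if "n \<in> N" "v \<in> W \<inter> ind_space G K" for n v
        using that W NG stable_ind_space[OF K.subgroup_axioms] unfolding stable_sub_def by blast
    qed simp
    then have "indicator (carrier G) \<in> W" if "W \<inter> ind_space G K \<noteq> {\<lambda>_. 0}"
      using indicator_mem_stable_sub[OF p N _ that cover] by blast
    moreover have "(indicator (carrier G) :: 'a \<Rightarrow> 'k) \<notin> W"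
      using one MW(2) indicator_carrier_nonzero by blast
    ultimately have "w = (\<lambda>_. 0)" using w by blast
    then show "f \<in> M" using mw by simp
  qed
qed

section \<open>Passing between the normalizer and \<open>G\<close>\<close>

lemma (in group) normal_in_normalizer:
  assumes P: "subgroup P G" "finite P"
  shows "P \<lhd> G\<lparr>carrier := normalizer G P\<rparr>"
proof -
  note N = subgroup_normalizer[OF P(1)]
  interpret N: group "G\<lparr>carrier := normalizer G P\<rparr>" using subgroup_imp_group[OF N] .
  have "subgroup P (G\<lparr>carrier := normalizer G P\<rparr>)"
    by (rule subgroup_incl[OF P(1) N subgroup_subset_normalizer[OF P]])
  then show ?thesis
    using normalizer_conj_closed[OF P(1)] m_inv_consistent[OF N]
    by (auto simp: N.normal_inv_iff)
qed

text \<open>If \<open>n = a c\<close> with \<open>c\<close> centralizing \<open>x\<inverse> Q x\<close>, then \<open>x c x\<inverse>\<close> centralizes \<open>Q\<close> and differs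
  from \<open>n\<close> by an element of the normal subgroup \<open>K\<close>.\<close>
lemma (in group) centralizer_cover_conjugate:
  assumes K: "K \<lhd> G" and x: "x \<in> K" and a: "a \<in> K" and c: "c \<in> carrier G" and Q: "Q \<subseteq> carrier G"
    and comm: "\<And>q. q \<in> Q \<Longrightarrow> c \<otimes> (inv x \<otimes> q \<otimes> x) = (inv x \<otimes> q \<otimes> x) \<otimes> c"
  obtains k c' where "k \<in> K" "c' \<in> centralizer G Q" "a \<otimes> c = k \<otimes> c'"
proof -
  interpret K: normal K G by (rule K)
  have xG: "x \<in> carrier G" and aG: "a \<in> carrier G" using x a by auto
  define c' where "c' = x \<otimes> c \<otimes> inv x"
  \<comment> \<open>This is \<open>a\<close> times the commutator of \<open>c\<close> and
    \<open>x\<close>; both factors lie in \<open>K\<close>, and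
    \<open>k \<otimes> c' = a \<otimes> c\<close>.\<close>
  define k where "k = a \<otimes> (c \<otimes> x \<otimes> inv c) \<otimes> inv x"
  have c'G: "c' \<in> carrier G" using xG c by (simp add: c'_def)
  have "k \<in> K" using a x K.inv_op_closed2[OF c x] by (simp add: k_def)
  moreover have "c' \<otimes> q = q \<otimes> c'" if q: "q \<in> Q" for q
  proof -
    have qG: "q \<in> carrier G" using q Q by blast
    have "c' \<otimes> q = x \<otimes> (c \<otimes> (inv x \<otimes> q \<otimes> x)) \<otimes> inv x"
      using xG c qG by (simp add: c'_def m_assoc)
    also have "\<dots> = x \<otimes> ((inv x \<otimes> q \<otimes> x) \<otimes> c) \<otimes> inv x" using comm[OF q] by simp
    also have "\<dots> = (x \<otimes> inv x) \<otimes> q \<otimes> c'"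
      using xG c qG unfolding c'_def by (simp only: m_assoc m_closed inv_closed)
    also have "\<dots> = q \<otimes> c'" using xG qG by simp
    finally show ?thesis .
  qed
  then have "c' \<in> centralizer G Q" using c'G by (simp add: centralizer_def)
  moreover have "k \<otimes> c' = a \<otimes> c \<otimes> x \<otimes> inv c \<otimes> (inv x \<otimes> x) \<otimes> c \<otimes> inv x"
    using xG aG c unfolding k_def c'_def by (simp only: m_assoc m_closed inv_closed)
  then have "k \<otimes> c' = a \<otimes> c \<otimes> x \<otimes> (inv c \<otimes> c) \<otimes> inv x"
    using xG aG c by (simp add: m_assoc)
  then have "k \<otimes> c' = a \<otimes> c" using xG aG c by (simp add: m_assoc)
  ultimately show thesis using that by metis
qed

theorem theorem1p4:
  fixes G :: "('g, 'b) monoid_scheme" and P :: "'g set" and p :: nat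
    and M :: "('g \<Rightarrow> 'k::field) set"
  assumes "prime p"
    and "CHAR('k) = p"
    and "alg_closed_field TYPE('k)"
    and "group G" and "finite (carrier G)"
    and "p_subgroup G p P"
    and "scott_module G P M"
    and "P \<subseteq> module_kernel G (ind_action G) M"
    and "p_group_set p (normalizer G P)"
    and "\<forall>M' :: ('g \<Rightarrow> 'k) set. scott_module (G\<lparr>carrier := normalizer G P\<rparr>) P M' \<longrightarrow>
           brauer_indecomposable (G\<lparr>carrier := normalizer G P\<rparr>) p
             (ind_action (G\<lparr>carrier := normalizer G P\<rparr>)) M'"
  shows "brauer_indecomposable G p (ind_action G) M"
proof -
  interpret group G by (rule assms(4))
  note p = assms(1,2) and fin = assms(5)
  define N where "N = normalizer G P"
  define GN where "GN = G\<lparr>carrier := N\<rparr>"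
  define K where "K = module_kernel G (ind_action G) M"
  have P: "subgroup P G" "finite P" using assms(6) by (auto simp: p_subgroup_def p_group_set_def)
  have PK: "P \<subseteq> K" using assms(8) K_def by simp
  have N: "subgroup N G" unfolding N_def by (rule subgroup_normalizer[OF P(1)])
  have NG: "N \<subseteq> carrier G" using N subgroup.subset by blast
  have pN: "p_subgroup G p N" using N assms(9) by (simp add: p_subgroup_def N_def)
  from assms(7) obtain W v where M: "stable_sub (carrier G) (ind_action G) (ind_space G P) M"
    and W: "stable_sub (carrier G) (ind_action G) (ind_space G P) W"
      "ssum M W = ind_space G P" "M \<inter> W = {\<lambda>_. 0}"
    and v: "v \<in> M" "v \<noteq> (\<lambda>_. 0)" "\<forall>g\<in>carrier G. ind_action G g v = v"
    unfolding scott_module_def by blast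
  have one: "indicator (carrier G) \<in> M" by (rule scott_module_indicator_mem[OF M P(1) v])
  have K: "K \<lhd> G" unfolding K_def by (rule module_kernel_normal[OF M])
  then interpret K: normal K G .
  have index: "\<not> p dvd card ((\<lambda>t. t <#\<^bsub>G\<^esub> P) ` K)"
    unfolding K_def by (rule index_in_module_kernel_not_dvd[OF p(2) fin P(1) M W one assms(8)])
  \<comment> \<open>The Frattini argument, in the form \<open>G = N K\<close>.\<close>
  have cover: "\<exists>n\<in>N. \<exists>k\<in>K. g = n \<otimes>\<^bsub>G\<^esub> k" if "g \<in> carrier G" for g
    using frattini_argument[OF p(1) fin K assms(6) PK index that] unfolding N_def by metis
  have MK: "M = ind_space G K"
    by (rule scott_module_eq_ind_space_kernel[OF p pN M W one K_def PK cover])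
  interpret GN: group GN unfolding GN_def by (rule subgroup_imp_group[OF N])
  have normP: "P \<lhd> GN" unfolding GN_def N_def by (rule normal_in_normalizer[OF P])
  \<comment> \<open>The hypothesis ranges over all Scott modules of the normalizer; the full
    permutation module on \<open>N / P\<close> is one, as \<open>N\<close> is a p-group.\<close>
  have BN: "brauer_indecomposable GN p (ind_action GN) (ind_space GN P :: ('g \<Rightarrow> 'k) set)"
  proof -
    have "scott_module GN P (ind_space GN P :: ('g \<Rightarrow> 'k) set)"
      by (rule GN.scott_module_of_p_group[OF p])
        (use assms(9) normal_imp_subgroup[OF normP] in \<open>simp_all add: GN_def N_def\<close>)
    then show ?thesis using assms(10) unfolding GN_def N_def by blast
  qed
  have finN: "finite (carrier GN)" using finite_subset[OF NG fin] by (simp add: GN_def)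
  have PN: "P \<subseteq> N" unfolding N_def by (rule subgroup_subset_normalizer[OF P])
  show ?thesis
    unfolding brauer_indecomposable_def
  proof (intro allI impI)
    fix Q assume Q: "p_subgroup G p Q"
    have Qs: "subgroup Q G" "Q \<subseteq> carrier G" using Q subgroup.subset by (auto simp: p_subgroup_def)
    show "subquot_indec_or_zero (Q <#>\<^bsub>G\<^esub> centralizer G Q) (ind_action G)
        (fixed_pts Q (ind_action G) M) (brauer_kernel G Q (ind_action G) M)"
    proof (cases "Q \<subseteq> K")
      case False
      \<comment> \<open>A \<open>C\<close> that contains the kernel and lies in the fixed points
        must then equal the kernel.\<close>
      then have "fixed_pts Q (ind_action G) M \<subseteq> brauer_kernel G Q (ind_action G) M"
        unfolding MK by (rule fixed_pts_subset_brauer_kernel[OF fin K Qs(1)])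
      then show ?thesis unfolding subquot_indec_or_zero_def stable_sub_def by blast
    next
      case True
      have triv: "ind_action G k f = f" if "k \<in> K" "f \<in> M" for k f
        using K.ind_action_trivial that MK by blast
      have fixM: "fixed_pts Q (ind_action G) M = M"
        using triv True by (auto simp: fixed_pts_def)
      have zero: "(\<lambda>_. 0) \<in> M" using M fsubspace_zero by (auto simp: stable_sub_def)
      have ker: "brauer_kernel G Q (ind_action G) M = {\<lambda>_. 0}"
        by (rule brauer_kernel_trivial_action[OF p fin Q zero]) (use triv True in blast)
      obtain x where x: "x \<in> K" "\<And>q. q \<in> Q \<Longrightarrow> inv\<^bsub>G\<^esub> x \<otimes>\<^bsub>G\<^esub> q \<otimes>\<^bsub>G\<^esub> x \<in> P"
        using p_subgroup_conjugate_into[OF p(1) fin K.subgroup_axioms P(1) PK index Q True] by metis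
      have xG: "x \<in> carrier G" using x(1) K.subset by blast
      \<comment> \<open>The conjugate of \<open>Q\<close> by \<open>inv x\<close> lies in
        \<open>P\<close>, hence in \<open>N\<close>, where \<open>BN\<close> can be applied to
        it.\<close>
      define Q' where "Q' = inv\<^bsub>G\<^esub> x <#\<^bsub>G\<^esub> Q #>\<^bsub>G\<^esub> inv\<^bsub>G\<^esub> (inv\<^bsub>G\<^esub> x)"
      have Q'_mem: "inv\<^bsub>G\<^esub> x \<otimes>\<^bsub>G\<^esub> q \<otimes>\<^bsub>G\<^esub> x \<in> Q'" if "q \<in> Q" for q
        using that xG by (auto simp: Q'_def l_coset_def r_coset_def)
      have Q'P: "Q' \<subseteq> P" using x xG by (auto simp: Q'_def l_coset_def r_coset_def)
      have "p_subgroup G p Q'" unfolding Q'_def by (rule p_subgroup_conj[OF Q inv_closed[OF xG]])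
      then have Q': "p_subgroup GN p Q'"
        using subgroup_incl[OF _ N, of Q'] Q'P PN unfolding p_subgroup_def GN_def by blast
      have coverN: "P <#>\<^bsub>GN\<^esub> centralizer GN Q' = carrier GN"
        by (rule GN.centralizer_cover_of_brauer_indecomposable[OF p finN normP BN Q' Q'P])
      \<comment> \<open>Conjugating back by \<open>x \<in> K\<close> changes only the factor in
        \<open>K\<close>, so \<open>N\<close> lies in the product of \<open>K\<close> and the
        centralizer of \<open>Q\<close>.\<close>
      have decomp: "\<exists>k\<in>K. \<exists>c\<in>centralizer G Q. n = k \<otimes>\<^bsub>G\<^esub> c" if n: "n \<in> N" for n
      proof -
        have "n \<in> P <#>\<^bsub>GN\<^esub> centralizer GN Q'" using coverN n by (simp add: GN_def)
        then obtain a c where ac: "a \<in> P" "c \<in> centralizer GN Q'" "n = a \<otimes>\<^bsub>G\<^esub> c"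
          by (auto simp: set_mult_def GN_def)
        have cG: "c \<in> carrier G"
          and comm: "\<And>q. q \<in> Q' \<Longrightarrow> c \<otimes>\<^bsub>G\<^esub> q = q \<otimes>\<^bsub>G\<^esub> c"
          using ac(2) NG by (auto simp: centralizer_def GN_def)
        have aK: "a \<in> K" using ac PK by blast
        obtain k c' where "k \<in> K" "c' \<in> centralizer G Q" "a \<otimes>\<^bsub>G\<^esub> c = k \<otimes>\<^bsub>G\<^esub> c'"
          by (rule centralizer_cover_conjugate[OF K x(1) aK cG Qs(2) comm[OF Q'_mem]])
        then show ?thesis using ac(3) by blast
      qed
      \<comment> \<open>\<open>K\<close> acts trivially on \<open>M\<close>, so by
        \<open>decomp\<close> stability under the centralizer gives stability under
        \<open>N\<close>, and every nonzero submodule contains the constants.\<close>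
      have one_mem: "indicator (carrier G) \<in> C"
        if C: "stable_sub (Q <#>\<^bsub>G\<^esub> centralizer G Q) (ind_action G) M C" "C \<noteq> {\<lambda>_. 0}" for C
      proof -
        have CM: "fsubspace C" "C \<subseteq> M"
          and stab: "\<And>h f. h \<in> Q <#>\<^bsub>G\<^esub> centralizer G Q \<Longrightarrow> f \<in> C \<Longrightarrow> ind_action G h f \<in> C"
          using C by (auto simp: stable_sub_def)
        have "ind_action G n f \<in> C" if n: "n \<in> N" and f: "f \<in> C" for n f
        proof -
          obtain k c where kc: "k \<in> K" "c \<in> centralizer G Q" "n = k \<otimes>\<^bsub>G\<^esub> c"
            using decomp[OF n] by blast
          have cG: "c \<in> carrier G" using kc by (simp add: centralizer_def)
          have "\<one>\<^bsub>G\<^esub> \<otimes>\<^bsub>G\<^esub> c \<in> Q <#>\<^bsub>G\<^esub> centralizer G Q"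
            using kc subgroup.one_closed[OF Qs(1)] unfolding set_mult_def by blast
          then have cf: "ind_action G c f \<in> C" using stab f cG by simp
          then have "ind_action G k (ind_action G c f) = ind_action G c f"
            using triv[OF kc(1)] CM by blast
          then show ?thesis using cf kc ind_action_mult[OF K.mem_carrier[OF kc(1)] cG, of f] by simp
        qed
        then have "stable_sub N (ind_action G) (ind_space G K) C"
          using CM MK by (simp add: stable_sub_def)
        then show ?thesis by (rule indicator_mem_stable_sub[OF p pN _ C(2) cover])
      qed
      show ?thesis
        unfolding fixM ker subquot_indec_or_zero_def
      proof (rule notI, elim exE conjE)
        fix C D :: "('g \<Rightarrow> 'k) set"
        assume "stable_sub (Q <#>\<^bsub>G\<^esub> centralizer G Q) (ind_action G) M C" "C \<noteq> {\<lambda>_. 0}"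
          "stable_sub (Q <#>\<^bsub>G\<^esub> centralizer G Q) (ind_action G) M D" "D \<noteq> {\<lambda>_. 0}"
          and CD: "C \<inter> D = {\<lambda>_. 0}"
        then have "indicator (carrier G) \<in> C" "indicator (carrier G) \<in> D"
          using one_mem by blast+
        then show False using CD indicator_carrier_nonzero by blast
      qed
    qed
  qed
qed

end
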